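(* Let $G=(V,E)$ be a decomposable graph that is not a clique star, and let the numbers of states satisfy $d_v\ge 2$ for all $v\in V$. Then $$\dim\big(\mathrm{Mixt}^2(\mathcal{M}_G)\big)=2\dim(\mathcal{M}_G)+1.$$
   Context: $G=(V,E)$ is a finite simple undirected graph; each $v\in V$ carries a positive integer $d_v$ (number of states). Write $[n]=\{1,\dots,n\}$; for $A\subseteq V$ let $\mathcal{R}_A=\prod_{v\in A}[d_v]$, $d_A=\prod_{v\in A}d_v$, $\mathcal{R}=\mathcal{R}_V$; for $i\in\mathcal{R}$, $i_A$ is its restriction to $A$. A clique is a (possibly empty) set of pairwise adjacent vertices; $\mathcal{C}(G)$ is the set of (inclusion-)maximal cliques. $G$ is decomposable if it is chordal: every cycle of length at least $4$ has a chord. $G$ is a clique star if it is a union of its maximal cliques $\widetilde C_1,\dots,\widetilde C_k$ and there is a (possibly empty) clique $S$ with $\widetilde C_i\cap\widetilde C_j=S$ for all $i\neq j$. $\Delta_n=\{p\in\mathbb{R}^n : p_i>0,\ p_1+\dots+p_n=1\}$ is the open simplex. With $m=\sum_{C\in\mathcal{C}(G)}d_C$, the monomial map $\phi^G:\mathbb{C}^m\to\mathbb{C}^{|\mathcal{R}|}$ is $\phi^G_i(\theta)=\prod_{C\in\mathcal{C}(G)}\theta^{(C)}_{i_C}$, and the discrete graphical model is $\mathcal{M}_G=\phi^G(\mathbb{C}^m)\cap\Delta_{|\mathcal{R}|}$. The $r$-th mixture model is $$\mathrm{Mixt}^r(\mathcal{M}_G)=\{\pi_1p^1+\dots+\pi_rp^r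 : (\pi_1,\dots,\pi_r)\in\Delta_r,\ p^1,\dots,p^r\in\mathcal{M}_G\}.$$ Dimension of a model means the dimension of its Zariski closure. *)

theory Defs
  imports "HOL-Analysis.Analysis" "HOL-Library.Ramsey" "HOL-Library.Extended_Nat"
begin

section \<open>Graphs\<close>

definition simple_graph :: "'v set \<Rightarrow> 'v set set \<Rightarrow> bool" where
  "simple_graph V E \<longleftrightarrow> finite V \<and> E \<subseteq> [V]\<^bsup>2\<^esup>"

text \<open>Maximal cliques; \<^const>\<open>clique\<close> is the notion from the Ramsey theory and admits the
  empty set.\<close>

definition max_cliques :: "'v set \<Rightarrow> 'v set set \<Rightarrow> 'v set set" where
  "max_cliques V E =
     {C. C \<subseteq> V \<and> clique C E \<and> (\<forall>D. D \<subseteq> V \<and> clique D E \<and> C \<subseteq> D \<longrightarrow> D = C)}"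

text \<open>A cycle is given by the list of its distinct vertices, in cyclic order.\<close>

definition cycle_edges :: "'v list \<Rightarrow> 'v set set" where
  "cycle_edges xs = {{xs ! i, xs ! (Suc i mod length xs)} | i. i < length xs}"

definition is_cycle :: "'v set \<Rightarrow> 'v set set \<Rightarrow> 'v list \<Rightarrow> bool" where
  "is_cycle V E xs \<longleftrightarrow>
     3 \<le> length xs \<and> distinct xs \<and> set xs \<subseteq> V \<and> cycle_edges xs \<subseteq> E"

definition has_chord :: "'v set set \<Rightarrow> 'v list \<Rightarrow> bool" where
  "has_chord E xs \<longleftrightarrow> (\<exists>e \<in> E. e \<subseteq> set xs \<and> e \<notin> cycle_edges xs)"

definition decomposable :: "'v set \<Rightarrow> 'v set set \<Rightarrow> bool" where
  "decomposable V E \<longleftrightarrow> (\<forall>xs. is_cycle V E xs \<and> 4 \<le> length xs \<longrightarrow> has_chord E xs)"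

text \<open>Every finite simple graph is the union of its maximal cliques, so only the condition on
  their pairwise intersections is stated. A graph with a single maximal clique is a
  clique star.\<close>

definition clique_star :: "'v set \<Rightarrow> 'v set set \<Rightarrow> bool" where
  "clique_star V E \<longleftrightarrow>
     (\<exists>S \<subseteq> V. clique S E \<and>
        (\<forall>C \<in> max_cliques V E. \<forall>D \<in> max_cliques V E. C \<noteq> D \<longrightarrow> C \<inter> D = S))"

section \<open>Affine space, Zariski topology and dimension\<close>

text \<open>Complex affine space with coordinates indexed by a set \<open>I\<close>; its points are the
  functions that are \<^const>\<open>undefined\<close> outside \<open>I\<close>.\<close>

definition affine_space :: "'i set \<Rightarrow> ('i \<Rightarrow> complex) set" where
  "affine_space I = (I \<rightarrow>\<^sub>E UNIV)"

text \<open>Polynomial functions in the coordinates indexed by \<open>I\<close>.\<close>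

inductive_set poly_funs :: "'i set \<Rightarrow> (('i \<Rightarrow> complex) \<Rightarrow> complex) set" for I :: "'i set" where
  const: "(\<lambda>x. c) \<in> poly_funs I"
| coord: "i \<in> I \<Longrightarrow> (\<lambda>x. x i) \<in> poly_funs I"
| add: "f \<in> poly_funs I \<Longrightarrow> g \<in> poly_funs I \<Longrightarrow> (\<lambda>x. f x + g x) \<in> poly_funs I"
| mult: "f \<in> poly_funs I \<Longrightarrow> g \<in> poly_funs I \<Longrightarrow> (\<lambda>x. f x * g x) \<in> poly_funs I"

definition zero_set :: "'i set \<Rightarrow> (('i \<Rightarrow> complex) \<Rightarrow> complex) set \<Rightarrow> ('i \<Rightarrow> complex) set" where
  "zero_set I P = {x \<in> affine_space I. \<forall>f \<in> P. f x = 0}"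

definition zariski_topology :: "'i set \<Rightarrow> ('i \<Rightarrow> complex) topology" where
  "zariski_topology I =
     topology (\<lambda>U. \<exists>P \<subseteq> poly_funs I. U = affine_space I - zero_set I P)"

lemma istopology_zariski:
  "istopology (\<lambda>U. \<exists>P \<subseteq> poly_funs I. U = affine_space I - zero_set I P)"
  unfolding istopology_def
proof (intro conjI allI impI)
  fix S T
  assume "\<exists>P \<subseteq> poly_funs I. S = affine_space I - zero_set I P"
    and "\<exists>P \<subseteq> poly_funs I. T = affine_space I - zero_set I P"
  then obtain P Q where P: "P \<subseteq> poly_funs I" "S = affine_space I - zero_set I P"
    and Q: "Q \<subseteq> poly_funs I" "T = affine_space I - zero_set I Q" by blast
  let ?R = "(\<lambda>(f, g) x. f x * g x) ` (P \<times> Q)"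
  have "?R \<subseteq> poly_funs I" using P(1) Q(1) by (auto intro: poly_funs.mult)
  moreover have "S \<inter> T = affine_space I - zero_set I ?R"
    unfolding P(2) Q(2) zero_set_def by fastforce
  ultimately show "\<exists>P \<subseteq> poly_funs I. S \<inter> T = affine_space I - zero_set I P" by blast
next
  fix K
  assume "\<forall>S \<in> K. \<exists>P \<subseteq> poly_funs I. S = affine_space I - zero_set I P"
  then obtain F where F: "\<And>S. S \<in> K \<Longrightarrow> F S \<subseteq> poly_funs I"
    "\<And>S. S \<in> K \<Longrightarrow> S = affine_space I - zero_set I (F S)" by metis
  have "\<Union> K = (\<Union>S \<in> K. affine_space I - zero_set I (F S))" using F(2) by auto
  also have "\<dots> = affine_space I - zero_set I (\<Union>S \<in> K. F S)"
    unfolding zero_set_def by blast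
  finally show "\<exists>P \<subseteq> poly_funs I. \<Union> K = affine_space I - zero_set I P"
    using F(1) by (intro exI[of _ "\<Union>S \<in> K. F S"]) blast
qed

lemma openin_zariski:
  "openin (zariski_topology I) U \<longleftrightarrow>
     (\<exists>P \<subseteq> poly_funs I. U = affine_space I - zero_set I P)"
  by (simp add: zariski_topology_def topology_inverse'[OF istopology_zariski])

lemma topspace_zariski [simp]: "topspace (zariski_topology I) = affine_space I"
proof
  show "topspace (zariski_topology I) \<subseteq> affine_space I"
    unfolding topspace_def openin_zariski by blast
  have "{\<lambda>x. 1} \<subseteq> poly_funs I" by (simp add: poly_funs.const)
  moreover have "affine_space I = affine_space I - zero_set I {\<lambda>x. 1}"
    by (auto simp: zero_set_def)
  ultimately have "openin (zariski_topology I) (affine_space I)"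
    unfolding openin_zariski by blast
  then show "affine_space I \<subseteq> topspace (zariski_topology I)" by (rule openin_subset)
qed

lemma closedin_zariski:
  "closedin (zariski_topology I) Z \<longleftrightarrow> (\<exists>P \<subseteq> poly_funs I. Z = zero_set I P)"
proof -
  have sub: "zero_set I P \<subseteq> affine_space I" for P by (auto simp: zero_set_def)
  show ?thesis
    unfolding closedin_def openin_zariski topspace_zariski
    using sub by (metis Diff_Diff_Int Int_absorb1)
qed

definition irreducible_space :: "'a topology \<Rightarrow> bool" where
  "irreducible_space X \<longleftrightarrow>
     topspace X \<noteq> {} \<and>
     (\<forall>A B. closedin X A \<and> closedin X B \<and> A \<union> B = topspace X \<longrightarrow>
        A = topspace X \<or> B = topspace X)"

text \<open>Krull dimension: the supremum of the lengths \<open>n\<close> of strict chains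
  \<open>Z 0 \<subset> \<dots> \<subset> Z n\<close> of irreducible closed subsets. The empty space has dimension \<open>0\<close>
  here rather than minus infinity.\<close>

definition krull_dim :: "'a topology \<Rightarrow> enat" where
  "krull_dim X = Sup {enat n | n.
     \<exists>Z. (\<forall>k \<le> n. closedin X (Z k) \<and> irreducible_space (subtopology X (Z k))) \<and>
         (\<forall>k < n. Z k \<subset> Z (Suc k))}"

text \<open>The dimension of a set of points: that of its Zariski closure in complex affine space.\<close>

definition model_dim :: "'i set \<Rightarrow> ('i \<Rightarrow> complex) set \<Rightarrow> enat" where
  "model_dim I M =
     krull_dim (subtopology (zariski_topology I) (zariski_topology I closure_of M))"

section \<open>Discrete graphical models and mixtures\<close>

text \<open>The open simplex, viewed inside complex affine space.\<close>

definition open_simplex :: "'i set \<Rightarrow> ('i \<Rightarrow> complex) set" where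
  "open_simplex I =
     {p \<in> affine_space I. (\<forall>i \<in> I. p i \<in> \<real> \<and> 0 < Re (p i)) \<and> (\<Sum>i \<in> I. p i) = 1}"

definition states :: "('v \<Rightarrow> nat) \<Rightarrow> 'v set \<Rightarrow> ('v \<Rightarrow> nat) set" where
  "states d A = (\<Pi>\<^sub>E v \<in> A. {1..d v})"

definition param_index :: "'v set \<Rightarrow> 'v set set \<Rightarrow> ('v \<Rightarrow> nat) \<Rightarrow> ('v set \<times> ('v \<Rightarrow> nat)) set" where
  "param_index V E d = (SIGMA C : max_cliques V E. states d C)"

definition monomial_map ::
  "'v set \<Rightarrow> 'v set set \<Rightarrow> ('v \<Rightarrow> nat) \<Rightarrow> ('v set \<times> ('v \<Rightarrow> nat) \<Rightarrow> complex) \<Rightarrow>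
     (('v \<Rightarrow> nat) \<Rightarrow> complex)" where
  "monomial_map V E d \<theta> =
     (\<lambda>i \<in> states d V. \<Prod>C \<in> max_cliques V E. \<theta> (C, restrict i C))"

definition graphical_model ::
  "'v set \<Rightarrow> 'v set set \<Rightarrow> ('v \<Rightarrow> nat) \<Rightarrow> (('v \<Rightarrow> nat) \<Rightarrow> complex) set" where
  "graphical_model V E d =
     monomial_map V E d ` affine_space (param_index V E d) \<inter> open_simplex (states d V)"

definition mixture :: "nat \<Rightarrow> 'i set \<Rightarrow> ('i \<Rightarrow> complex) set \<Rightarrow> ('i \<Rightarrow> complex) set" where
  "mixture r I M =
     {(\<lambda>i \<in> I. \<Sum>k = 1..r. \<pi> k * p k i) | \<pi> p.
        \<pi> \<in> open_simplex {1..r} \<and> (\<forall>k \<in> {1..r}. p k \<in> M)}"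

end

theory Submission
  imports Defs "HOL-Computational_Algebra.Polynomial"
begin

text \<open>
  The logarithms of the distributions in the model are sums of functions of the clique marginals.
  With state 1 as reference state at each vertex, the space of these sums has a basis indexed by
  the states \<open>t\<close> whose support, the set of vertices not in state 1, is a clique; the basis function of
  \<open>t\<close> is the indicator of those \<open>i\<close> that agree with \<open>t\<close> on the support of \<open>t\<close>. Multiplicatively,
  the model is the image of a monomial map on a positive orthant, divided by the coordinate sum
  (\<open>graphical_model_eq\<close>). Let \<open>N\<close> be the number of basis functions other than the constant. The
  model has \<open>N\<close> parameters, and the second mixture has \<open>2 N + 1\<close>, the additional one accounting for
  the mixture weights (\<open>mixture_eq\<close>). It remains to prove that these numbers are the dimensions.

  The Krull dimension of such a normalized image is computed by counting monomials
  (\<open>model_dim_normalized_image\<close>). A chain of \<open>m + 1\<close> irreducible closed sets yields \<open>m\<close>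
  algebraically independent functions (\<open>chain_independent\<close>), whereas more functions than
  parameters are dependent (\<open>forms_dependent\<close>); so the dimension is at most the number of
  parameters. If the parametrization of the cone over the image is an immersion at one point, linear
  forms dual to its Jacobian are independent by comparison of the terms of lowest order
  (\<open>lowest_order_independence\<close>). Hence the closures of the images of a flag of coordinate subspaces
  are distinct and form a chain of maximal length.

  For the model the Jacobian is triangular. For the mixture, at two points of the model whose ratio
  is \<open>r\<close>, immersivity means that \<open>g + r h = 0\<close> has no nonzero solution with \<open>g\<close> and \<open>h\<close> sums of
  functions of the clique marginals. Such sums have vanishing mixed differences across nonadjacent
  pairs of vertices. Written for both \<open>h\<close> and \<open>r h\<close> this gives, for each nonadjacent pair \<open>u, v\<close>, a
  relation \<open>h + e u + e v = 0\<close> between \<open>h\<close> and suitably rescaled differences of \<open>h\<close> at \<open>u\<close> and \<open>v\<close>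
  (\<open>slope_sum\<close>). For an explicit \<open>r\<close> these relations force \<open>h = 0\<close> as soon as the graph contains
  three pairwise nonadjacent vertices (\<open>transversal_triple\<close>), or vertices \<open>s, p, q, t\<close> with \<open>p, q\<close>
  adjacent and \<open>s, t\<close>, \<open>s, q\<close> and \<open>t, p\<close> nonadjacent (\<open>transversal_path\<close>). A decomposable graph
  containing neither configuration is a clique star (\<open>not_clique_star_cases\<close>).
\<close>

section \<open>Zariski closures and irreducible sets\<close>

lemma zero_set_closed: "P \<subseteq> poly_funs I \<Longrightarrow> closedin (zariski_topology I) (zero_set I P)"
  by (auto simp: closedin_zariski)

lemma in_closure_iff:
  assumes "X \<subseteq> affine_space I"
  shows "x \<in> zariski_topology I closure_of X \<longleftrightarrow>
    x \<in> affine_space I \<and> (\<forall>f \<in> poly_funs I. (\<forall>y \<in> X. f y = 0) \<longrightarrow> f x = 0)"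
proof
  assume x: "x \<in> zariski_topology I closure_of X"
  have "x \<in> affine_space I"
    using x closure_of_subset_topspace[of "zariski_topology I" X] by auto
  moreover have "f x = 0" if "f \<in> poly_funs I" "\<forall>y \<in> X. f y = 0" for f
  proof -
    have "X \<subseteq> zero_set I {f}" using assms that by (auto simp: zero_set_def)
    then have "zariski_topology I closure_of X \<subseteq> zero_set I {f}"
      using that by (intro closure_of_minimal zero_set_closed) auto
    then show ?thesis using x by (auto simp: zero_set_def)
  qed
  ultimately show "x \<in> affine_space I \<and> (\<forall>f \<in> poly_funs I. (\<forall>y \<in> X. f y = 0) \<longrightarrow> f x = 0)"
    by blast
next
  assume x: "x \<in> affine_space I \<and> (\<forall>f \<in> poly_funs I. (\<forall>y \<in> X. f y = 0) \<longrightarrow> f x = 0)"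
  have "closedin (zariski_topology I) (zariski_topology I closure_of X)" by simp
  then obtain P where P: "P \<subseteq> poly_funs I" "zariski_topology I closure_of X = zero_set I P"
    unfolding closedin_zariski by blast
  have "X \<subseteq> zero_set I P" using closure_of_subset[of X "zariski_topology I"] assms P by simp
  then have "\<forall>f \<in> P. \<forall>y \<in> X. f y = 0" by (auto simp: zero_set_def)
  then have "\<forall>f \<in> P. f x = 0" using x P(1) by blast
  then show "x \<in> zariski_topology I closure_of X"
    using x unfolding P(2) zero_set_def by simp
qed

lemma irreducible_iff:
  assumes Z: "Z \<subseteq> affine_space I"
  shows "irreducible_space (subtopology (zariski_topology I) Z) \<longleftrightarrow>
    Z \<noteq> {} \<and> (\<forall>f \<in> poly_funs I. \<forall>g \<in> poly_funs I. (\<forall>x \<in> Z. f x * g x = 0) \<longrightarrow>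
      (\<forall>x \<in> Z. f x = 0) \<or> (\<forall>x \<in> Z. g x = 0))"
    (is "?L \<longleftrightarrow> ?R")
proof
  have top: "topspace (subtopology (zariski_topology I) Z) = Z"
    using Z by auto
  {
    assume L: ?L
    have "(\<forall>x \<in> Z. f x = 0) \<or> (\<forall>x \<in> Z. g x = 0)"
      if fg: "f \<in> poly_funs I" "g \<in> poly_funs I" "\<forall>x \<in> Z. f x * g x = 0" for f g
    proof -
      have c: "closedin (subtopology (zariski_topology I) Z) (zero_set I {h} \<inter> Z)"
        if "h \<in> poly_funs I" for h
        using that zero_set_closed[of "{h}" I] unfolding closedin_subtopology by blast
      have "zero_set I {f} \<inter> Z \<union> zero_set I {g} \<inter> Z = Z"
        using fg(3) Z by (auto simp: zero_set_def)
      then have "zero_set I {f} \<inter> Z = Z \<or> zero_set I {g} \<inter> Z = Z"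
        using L c[OF fg(1)] c[OF fg(2)] unfolding irreducible_space_def top by blast
      then show ?thesis by (auto simp: zero_set_def)
    qed
    then show ?R using L unfolding irreducible_space_def top by blast
  }
  {
    assume R: ?R
    have "A = Z \<or> B = Z"
      if A: "closedin (subtopology (zariski_topology I) Z) A"
        and B: "closedin (subtopology (zariski_topology I) Z) B" and AB: "A \<union> B = Z" for A B
    proof (rule ccontr)
      assume neg: "\<not> (A = Z \<or> B = Z)"
      obtain P where P: "P \<subseteq> poly_funs I" "A = zero_set I P \<inter> Z"
        using A unfolding closedin_subtopology closedin_zariski by blast
      obtain Q where Q: "Q \<subseteq> poly_funs I" "B = zero_set I Q \<inter> Z"
        using B unfolding closedin_subtopology closedin_zariski by blast
      obtain f x where f: "f \<in> P" "x \<in> Z" "f x \<noteq> 0"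
        using neg P Z by (auto simp: zero_set_def)
      obtain g y where g: "g \<in> Q" "y \<in> Z" "g y \<noteq> 0"
        using neg Q Z by (auto simp: zero_set_def)
      have "\<forall>x \<in> Z. f x * g x = 0"
        using AB P Q f g by (auto simp: zero_set_def)
      then show False using R f g P Q by blast
    qed
    then show ?L using R unfolding irreducible_space_def top by blast
  }
qed

section \<open>Polynomial functions\<close>

lemma poly_funs_cmult: "f \<in> poly_funs I \<Longrightarrow> (\<lambda>x. c * f x) \<in> poly_funs I"
  by (intro poly_funs.intros)

lemma poly_funs_sum:
  "(\<And>a. a \<in> A \<Longrightarrow> f a \<in> poly_funs I) \<Longrightarrow> (\<lambda>x. \<Sum>a \<in> A. f a x) \<in> poly_funs I"
proof (induction A rule: infinite_finite_induct)
  case (insert a A)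
  then show ?case by (simp add: poly_funs.add)
qed (simp_all add: poly_funs.const)

lemma poly_funs_prod:
  "(\<And>a. a \<in> A \<Longrightarrow> f a \<in> poly_funs I) \<Longrightarrow> (\<lambda>x. \<Prod>a \<in> A. f a x) \<in> poly_funs I"
proof (induction A rule: infinite_finite_induct)
  case (insert a A)
  then show ?case by (simp add: poly_funs.mult)
qed (simp_all add: poly_funs.const)

lemma poly_funs_power: "f \<in> poly_funs I \<Longrightarrow> (\<lambda>x. f x ^ n) \<in> poly_funs I"
  by (induction n) (simp_all add: poly_funs.intros)

lemma poly_funs_cong:
  "f \<in> poly_funs I \<Longrightarrow> (\<And>i. i \<in> I \<Longrightarrow> x i = y i) \<Longrightarrow> f x = f y"
  by (induction rule: poly_funs.induct) simp_all

lemma poly_funs_specialize: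
  "f \<in> poly_funs J \<Longrightarrow> (\<lambda>u. f (\<lambda>j. if j \<in> K then u j else w j)) \<in> poly_funs K"
proof (induction rule: poly_funs.induct)
  case (coord i)
  then show ?case by (cases "i \<in> K") (simp_all add: poly_funs.intros)
qed (simp_all add: poly_funs.intros)

lemma poly_funs_on_line:
  "f \<in> poly_funs J \<Longrightarrow> \<exists>p. \<forall>s. f (\<lambda>j. x j + s * v j) = poly p s"
proof (induction rule: poly_funs.induct)
  case (const c)
  show ?case by (rule exI[of _ "[:c:]"]) simp
next
  case (coord i)
  show ?case by (rule exI[of _ "[:x i, v i:]"]) simp
next
  case (add f g)
  then obtain p q where "\<forall>s. f (\<lambda>j. x j + s * v j) = poly p s"
    "\<forall>s. g (\<lambda>j. x j + s * v j) = poly q s" by blast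
  then show ?case by (intro exI[of _ "p + q"]) simp
next
  case (mult f g)
  then obtain p q where "\<forall>s. f (\<lambda>j. x j + s * v j) = poly p s"
    "\<forall>s. g (\<lambda>j. x j + s * v j) = poly q s" by blast
  then show ?case by (intro exI[of _ "p * q"]) simp
qed

definition orthant :: "'j set \<Rightarrow> ('j \<Rightarrow> complex) set" where
  "orthant J = {u. \<forall>j \<in> J. u j \<in> \<real> \<and> 0 < Re (u j)}"

text \<open>The orthant is convex, and on the segment between two of its points polynomial functions
  become polynomials in one variable, of which only the zero polynomial has infinitely many
  roots.\<close>

lemma orthant_domain:
  assumes f: "f \<in> poly_funs J" and g: "g \<in> poly_funs J"
    and fg: "\<And>u. u \<in> orthant J \<Longrightarrow> f u * g u = 0"
  shows "(\<forall>u \<in> orthant J. f u = 0) \<or> (\<forall>u \<in> orthant J. g u = 0)"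
proof (rule ccontr)
  assume "\<not> ?thesis"
  then obtain x y where x: "x \<in> orthant J" "f x \<noteq> 0" and y: "y \<in> orthant J" "g y \<noteq> 0" by blast
  let ?l = "\<lambda>s j. x j + s * (y j - x j)"
  obtain p where p: "\<And>s. f (?l s) = poly p s" 
    using poly_funs_on_line[OF f, of x "\<lambda>j. y j - x j"] by blast
  obtain q where q: "\<And>s. g (?l s) = poly q s" 
    using poly_funs_on_line[OF g, of x "\<lambda>j. y j - x j"] by blast
  have "poly p 0 \<noteq> 0" "poly q 1 \<noteq> 0" using p[of 0] q[of 1] x y by auto
  then have pq: "p * q \<noteq> 0" by auto
  have "poly (p * q) (of_real s) = 0" if s: "0 \<le> s" "s \<le> 1" for s :: real
  proof -
    have "?l (of_real s) \<in> orthant J"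
      unfolding orthant_def
    proof (intro CollectI ballI conjI)
      fix j assume j: "j \<in> J"
      have r: "x j \<in> \<real>" "y j \<in> \<real>" "0 < Re (x j)" "0 < Re (y j)"
        using x(1) y(1) j by (auto simp: orthant_def)
      show "?l (of_real s) j \<in> \<real>" using r by simp
      have e: "Re (?l (of_real s) j) = (1 - s) * Re (x j) + s * Re (y j)"
        by (simp add: algebra_simps)
      show "0 < Re (?l (of_real s) j)"
      proof (cases "s = 0")
        case False
        then show ?thesis unfolding e using r s by (intro add_nonneg_pos mult_pos_pos) auto
      qed (use r in simp)
    qed
    then show ?thesis using fg p q by (metis poly_mult)
  qed
  then have "complex_of_real ` {0..1} \<subseteq> {s. poly (p * q) s = 0}" by fastforce
  then have "finite (complex_of_real ` {0..1})"
    using poly_roots_finite[OF pq] by (rule finite_subset)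
  then have "finite {0..1::real}" by (rule finite_imageD) (auto simp: inj_on_def)
  then show False using infinite_Icc[of 0 "1::real"] by simp
qed

text \<open>Polynomial functions in which every variable has degree at most \<open>D\<close>; unlike the total
  degree this makes the monomials easy to count.\<close>

inductive_set box_polys :: "'j set \<Rightarrow> nat \<Rightarrow> (('j \<Rightarrow> complex) \<Rightarrow> complex) set" for J D where
  zero: "(\<lambda>u. 0) \<in> box_polys J D"
| add_monom: "f \<in> box_polys J D \<Longrightarrow> e \<in> J \<rightarrow>\<^sub>E {..D} \<Longrightarrow>
     (\<lambda>u. c * (\<Prod>j \<in> J. u j ^ e j) + f u) \<in> box_polys J D"

lemma box_polys_monom: "e \<in> J \<rightarrow>\<^sub>E {..D} \<Longrightarrow> (\<lambda>u. c * (\<Prod>j \<in> J. u j ^ e j)) \<in> box_polys J D"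
  using box_polys.add_monom[OF box_polys.zero] by simp

lemma box_polys_add:
  assumes "f \<in> box_polys J D" "g \<in> box_polys J D"
  shows "(\<lambda>u. f u + g u) \<in> box_polys J D"
  using assms(1)
proof (induction rule: box_polys.induct)
  case (add_monom f e c)
  from box_polys.add_monom[OF add_monom(3) add_monom(2), of c] show ?case
    by (simp add: add.assoc)
qed (simp add: assms(2))

lemma box_polys_mono: "f \<in> box_polys J D \<Longrightarrow> D \<le> D' \<Longrightarrow> f \<in> box_polys J D'"
proof (induction rule: box_polys.induct)
  case (add_monom f e c)
  have "e \<in> J \<rightarrow>\<^sub>E {..D'}" 
    using add_monom(2) order_trans[OF _ add_monom(4)] by (auto simp: PiE_iff)
  from box_polys.add_monom[OF add_monom(3)[OF add_monom(4)] this, of c] show ?case .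
qed (simp add: box_polys.zero)

lemma box_polys_mult:
  assumes f: "f \<in> box_polys J D" and g: "g \<in> box_polys J D'"
  shows "(\<lambda>u. f u * g u) \<in> box_polys J (D + D')"
proof -
  have monom: "(\<lambda>u. c * (\<Prod>j \<in> J. u j ^ e j) * g u) \<in> box_polys J (D + D')"
    if e: "e \<in> J \<rightarrow>\<^sub>E {..D}" for c e
    using g
  proof (induction rule: box_polys.induct)
    case (add_monom h e' c')
    let ?e = "\<lambda>j \<in> J. e j + e' j"
    have "?e \<in> J \<rightarrow>\<^sub>E {..D + D'}"
      using e add_monom(2) by (auto simp: PiE_iff intro!: add_mono)
    moreover have "c * (\<Prod>j \<in> J. u j ^ e j) * (c' * (\<Prod>j \<in> J. u j ^ e' j) + h u) =
      c * c' * (\<Prod>j \<in> J. u j ^ ?e j) + c * (\<Prod>j \<in> J. u j ^ e j) * h u" for u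
      by (simp add: power_add prod.distrib algebra_simps)
    ultimately show ?case using box_polys.add_monom[OF add_monom(3), of ?e "c * c'"] by simp
  qed (simp add: box_polys.zero)
  show ?thesis using f
  proof (induction rule: box_polys.induct)
    case (add_monom h e c)
    show ?case using box_polys_add[OF monom[OF add_monom(2)] add_monom(3)]
      by (simp add: distrib_right)
  qed (simp add: box_polys.zero)
qed

lemma box_polys_const: "finite J \<Longrightarrow> (\<lambda>u. c) \<in> box_polys J D"
  using box_polys_monom[of "\<lambda>j \<in> J. 0" J D c] by simp

lemma poly_funs_box:
  assumes "finite J" "f \<in> poly_funs J"
  shows "\<exists>D. f \<in> box_polys J D"
  using assms(2)
proof (induction rule: poly_funs.induct)
  case (const c)
  show ?case using box_polys_const[OF assms(1)] by blast
next
  case (coord i)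
  let ?e = "\<lambda>j \<in> J. if j = i then 1 else (0::nat)"
  have "(\<Prod>j \<in> J. u j ^ ?e j) = u i" for u :: "'a \<Rightarrow> complex"
  proof -
    have "(\<Prod>j \<in> J. u j ^ ?e j) = (\<Prod>j \<in> J. if j = i then u j else 1)"
      by (intro prod.cong) auto
    then show ?thesis using coord assms(1) by simp
  qed
  moreover have "?e \<in> J \<rightarrow>\<^sub>E {..1}" by (auto simp: PiE_iff)
  ultimately show ?case using box_polys_monom[of ?e J 1 1] by auto
next
  case (add f g)
  then obtain D D' where "f \<in> box_polys J D" "g \<in> box_polys J D'" by blast
  then show ?case
    using box_polys_mono[of f J D "max D D'"] box_polys_mono[of g J D' "max D D'"]
    by (auto intro: box_polys_add)
next
  case (mult f g)
  then show ?case using box_polys_mult by blast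
qed

lemma box_polys_coeffs:
  assumes "finite J" "f \<in> box_polys J D"
  shows "\<exists>M. \<forall>u. f u = (\<Sum>e \<in> J \<rightarrow>\<^sub>E {..D}. M e * (\<Prod>j \<in> J. u j ^ e j))"
  using assms(2)
proof (induction rule: box_polys.induct)
  case zero
  show ?case by (rule exI[of _ "\<lambda>_. 0"]) simp
next
  case (add_monom f e c)
  then obtain M where M: "\<And>u. f u = (\<Sum>e \<in> J \<rightarrow>\<^sub>E {..D}. M e * (\<Prod>j \<in> J. u j ^ e j))" by blast
  have fin: "finite (J \<rightarrow>\<^sub>E {..D})" using assms(1) by (simp add: finite_PiE)
  have "c * (\<Prod>j \<in> J. u j ^ e j) + f u =
    (\<Sum>e' \<in> J \<rightarrow>\<^sub>E {..D}. (M e' + (if e' = e then c else 0)) * (\<Prod>j \<in> J. u j ^ e' j))" for u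
    unfolding M distrib_right sum.distrib
    using fin add_monom(2) by (simp add: if_distrib[of "\<lambda>x. x * _"] sum.delta cong: if_cong)
  then show ?case by (intro exI[of _ "\<lambda>e'. M e' + (if e' = e then c else 0)"] allI)
qed

text \<open>Gaussian elimination: an equation in which some unknown has a nonzero coefficient removes one
  equation and one unknown.\<close>

lemma nontrivial_relation:
  fixes M :: "'a \<Rightarrow> 'b \<Rightarrow> complex"
  assumes "finite B" "finite A" "card B < card A"
  shows "\<exists>c. (\<exists>a \<in> A. c a \<noteq> 0) \<and> (\<forall>b \<in> B. (\<Sum>a \<in> A. c a * M a b) = 0)"
  using assms
proof (induction B arbitrary: A M rule: finite_induct)
  case empty
  then obtain a where "a \<in> A" by fastforce
  then show ?case by (intro exI[of _ "\<lambda>_. 1"]) auto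
next
  case (insert b B)
  show ?case
  proof (cases "\<forall>a \<in> A. M a b = 0")
    case True
    obtain c where "\<exists>a \<in> A. c a \<noteq> 0" "\<forall>b \<in> B. (\<Sum>a \<in> A. c a * M a b) = 0"
      
      using insert.IH[OF insert.prems(1), of M] insert.prems(2) insert.hyps by auto
    then show ?thesis using True by (intro exI[of _ c]) auto
  next
    case False
    then obtain a0 where a0: "a0 \<in> A" "M a0 b \<noteq> 0" by blast
    let ?A = "A - {a0}"
    let ?M = "\<lambda>a b'. M a b' - M a b / M a0 b * M a0 b'"
    have "card B < card ?A" "finite ?A" using insert a0 by simp_all
    then obtain c where c: "\<exists>a \<in> ?A. c a \<noteq> 0" "\<forall>b' \<in> B. (\<Sum>a \<in> ?A. c a * ?M a b') = 0"
      
      using insert.IH[of ?A ?M] by blast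
    let ?c = "c(a0 := - (\<Sum>a \<in> ?A. c a * (M a b / M a0 b)))"
    have s: "(\<Sum>a \<in> A. ?c a * M a b') = (\<Sum>a \<in> ?A. c a * ?M a b')" for b'
    proof -
      have "(\<Sum>a \<in> A. ?c a * M a b') = ?c a0 * M a0 b' + (\<Sum>a \<in> ?A. ?c a * M a b')"
        using a0 insert by (simp add: sum.remove)
      also have "(\<Sum>a \<in> ?A. ?c a * M a b') = (\<Sum>a \<in> ?A. c a * M a b')"
        by (intro sum.cong) auto
      also have "?c a0 * M a0 b' + \<dots> = (\<Sum>a \<in> ?A. c a * ?M a b')"
        by (simp add: sum_distrib_right right_diff_distrib sum_subtractf mult.assoc)
      finally show ?thesis .
    qed
    have "(\<Sum>a \<in> A. ?c a * M a b) = 0" unfolding s using a0 by simp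
    then have "\<forall>b' \<in> insert b B. (\<Sum>a \<in> A. ?c a * M a b') = 0" using s c by auto
    moreover have "\<exists>a \<in> A. ?c a \<noteq> 0" using c by auto
    ultimately show ?thesis by blast
  qed
qed

lemma sum_PiE_insert:
  fixes F :: "('l \<Rightarrow> 'b) \<Rightarrow> 'c::comm_monoid_add"
  assumes "l \<notin> L"
  shows "(\<Sum>a \<in> insert l L \<rightarrow>\<^sub>E B. F a) = (\<Sum>b \<in> B. \<Sum>a \<in> L \<rightarrow>\<^sub>E B. F (a(l := b)))"
proof -
  have "inj_on (\<lambda>(y, g). g(l := y)) (B \<times> (L \<rightarrow>\<^sub>E B))"
    using assms by (rule inj_combinator)
  then have "(\<Sum>a \<in> insert l L \<rightarrow>\<^sub>E B. F a) = (\<Sum>(b, a) \<in> B \<times> (L \<rightarrow>\<^sub>E B). F (a(l := b)))"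
    unfolding PiE_insert_eq by (subst sum.reindex) (auto simp: case_prod_unfold intro!: sum.cong)
  then show ?thesis by (simp add: sum.cartesian_product)
qed

lemma vanishing_poly_coeffs:
  assumes "finite L"
    and "\<And>v :: 'l \<Rightarrow> real. (\<Sum>a \<in> L \<rightarrow>\<^sub>E {..k}. c a * (\<Prod>l \<in> L. complex_of_real (v l) ^ a l)) = 0"
    and "a \<in> L \<rightarrow>\<^sub>E {..k}"
  shows "c a = 0"
  using assms
proof (induction L arbitrary: c a rule: finite_induct)
  case empty
  then show ?case by simp
next
  case (insert l L)
  let ?G = "\<lambda>v b. \<Sum>a \<in> L \<rightarrow>\<^sub>E {..k}. c (a(l := b)) * (\<Prod>l \<in> L. complex_of_real (v l) ^ a l)"
  have G: "?G v b = 0" if b: "b \<le> k" for v :: "'l \<Rightarrow> real" and b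
  proof (rule ccontr)
    assume ne: "?G v b \<noteq> 0"
    have "(\<Sum>b\<le>k. ?G v b * complex_of_real x ^ b) = 0" for x
    proof -
      have "0 = (\<Sum>a \<in> insert l L \<rightarrow>\<^sub>E {..k}. c a *
          (\<Prod>l' \<in> insert l L. complex_of_real ((v(l := x)) l') ^ a l'))"
        using insert.prems(1) by simp
      also have "\<dots> = (\<Sum>b\<le>k. \<Sum>a \<in> L \<rightarrow>\<^sub>E {..k}. c (a(l := b)) *
          (\<Prod>l' \<in> insert l L. complex_of_real ((v(l := x)) l') ^ (a(l := b)) l'))"
        using insert.hyps by (intro sum_PiE_insert)
      also have "\<dots> = (\<Sum>b\<le>k. ?G v b * complex_of_real x ^ b)"
        unfolding sum_distrib_right
      proof (intro sum.cong refl)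
        fix b a
        have "(\<Prod>l' \<in> L. complex_of_real ((v(l := x)) l') ^ (a(l := b)) l') =
          (\<Prod>l \<in> L. complex_of_real (v l) ^ a l)"
          using insert.hyps by (intro prod.cong) auto
        then show "c (a(l := b)) *
          (\<Prod>l' \<in> insert l L. complex_of_real ((v(l := x)) l') ^ (a(l := b)) l') =
          c (a(l := b)) * (\<Prod>l \<in> L. complex_of_real (v l) ^ a l) * complex_of_real x ^ b"
          using insert.hyps by simp
      qed
      finally show ?thesis by simp
    qed
    then have "range complex_of_real \<subseteq> {z. (\<Sum>b\<le>k. ?G v b * z ^ b) = 0}" by auto
    moreover have "finite {z. (\<Sum>b\<le>k. ?G v b * z ^ b) = 0}"
      using polyfun_finite_roots[of "?G v" k] b ne by blast
    ultimately have "finite (range complex_of_real)" using finite_subset by blast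
    then show False using finite_imageD[of complex_of_real UNIV] infinite_UNIV_char_0
      by (auto simp: inj_on_def)
  qed
  obtain b a' where a: "a = a'(l := b)" "b \<le> k" "a' \<in> L \<rightarrow>\<^sub>E {..k}"
    using insert.prems(2) unfolding PiE_insert_eq by auto
  have "c (a'(l := b)) = 0"
    by (rule insert.IH[of "\<lambda>a. c (a(l := b))" a']) (use G a in auto)
  then show ?case unfolding a(1) .
qed

section \<open>Forms on the hyperplane of coordinate sum one\<close>

text \<open>Homogeneous polynomial functions. On the sets considered below the coordinates sum to one, so
  every polynomial function agrees there with a form, and for a form the normalization by the
  coordinate sum is only a scalar factor. Working with forms is what makes the normalization cost
  nothing in the count of monomials.\<close>

inductive is_form :: "'i set \<Rightarrow> nat \<Rightarrow> (('i \<Rightarrow> complex) \<Rightarrow> complex) \<Rightarrow> bool" for I where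
  zero: "is_form I n (\<lambda>x. 0)"
| const: "is_form I 0 (\<lambda>x. c)"
| coord: "is_form I n h \<Longrightarrow> i \<in> I \<Longrightarrow> is_form I (Suc n) (\<lambda>x. x i * h x)"
| add: "is_form I n h \<Longrightarrow> is_form I n g \<Longrightarrow> is_form I n (\<lambda>x. h x + g x)"

definition forms :: "'i set \<Rightarrow> nat \<Rightarrow> (('i \<Rightarrow> complex) \<Rightarrow> complex) set" where
  "forms I n = Collect (is_form I n)"

lemma is_form_iff: "is_form I n h \<longleftrightarrow> h \<in> forms I n"
  by (simp add: forms_def)

lemmas forms_zero = is_form.zero[unfolded is_form_iff]
lemmas forms_const = is_form.const[unfolded is_form_iff]
lemmas forms_coord = is_form.coord[unfolded is_form_iff]
lemmas forms_add = is_form.add[unfolded is_form_iff]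
lemmas forms_induct [consumes 1, case_names zero const coord add] =
  is_form.induct[unfolded is_form_iff]

lemma forms_cmult: "h \<in> forms I n \<Longrightarrow> (\<lambda>x. c * h x) \<in> forms I n"
proof (induction rule: forms_induct)
  case (coord h n i)
  then show ?case using forms_coord[OF coord(3) coord(2)] by (simp add: mult.left_commute)
next
  case (add h n g)
  then show ?case using forms_add[OF add(3,4)] by (simp add: distrib_left)
qed (simp_all add: forms_zero forms_const)

lemma forms_mult:
  assumes "h \<in> forms I m" "g \<in> forms I n"
  shows "(\<lambda>x. h x * g x) \<in> forms I (m + n)"
  using assms(1)
proof (induction rule: forms_induct)
  case (const c)
  then show ?case using forms_cmult[OF assms(2)] by simp
next
  case (coord h m i)
  then show ?case using forms_coord[OF coord(3) coord(2)] by (simp add: mult.assoc)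
next
  case (add h m h')
  then show ?case using forms_add[OF add(3,4)] by (simp add: distrib_right)
qed (simp add: forms_zero)

lemma forms_sum:
  "(\<And>a. a \<in> A \<Longrightarrow> h a \<in> forms I n) \<Longrightarrow> (\<lambda>x. \<Sum>a \<in> A. h a x) \<in> forms I n"
proof (induction A rule: infinite_finite_induct)
  case (insert a A)
  have "(\<lambda>x. h a x + (\<Sum>a \<in> A. h a x)) \<in> forms I n"
    by (rule forms_add) (use insert in auto)
  then show ?case using insert by simp
qed (simp_all add: forms_zero)

lemma forms_power: "h \<in> forms I n \<Longrightarrow> (\<lambda>x. h x ^ k) \<in> forms I (n * k)"
proof (induction k)
  case (Suc k)
  then show ?case using forms_mult[OF Suc(2) Suc(1)[OF Suc(2)]] by simp
qed (simp add: forms_const)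

lemma forms_prod_power:
  assumes "finite L" "\<And>l. l \<in> L \<Longrightarrow> h l \<in> forms I n"
  shows "(\<lambda>x. \<Prod>l \<in> L. h l x ^ a l) \<in> forms I (n * sum a L)"
  using assms
proof (induction L rule: finite_induct)
  case empty
  show ?case using forms_const[of 1 I] by simp
next
  case (insert l L)
  have "(\<lambda>x. h l x ^ a l * (\<Prod>l \<in> L. h l x ^ a l)) \<in> forms I (n * a l + n * sum a L)"
    by (intro forms_mult forms_power insert) (use insert in auto)
  then show ?case using insert by (simp add: distrib_left)
qed

lemma forms_linear: "(\<lambda>x. \<Sum>i \<in> I. b i * x i) \<in> forms I 1"
proof (rule forms_sum)
  fix i assume "i \<in> I"
  then show "(\<lambda>x. b i * x i) \<in> forms I 1"
    using forms_coord[OF forms_const, of i I "b i"] by (simp add: mult.commute)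
qed

lemma forms_poly: "h \<in> forms I n \<Longrightarrow> h \<in> poly_funs I"
  by (induction rule: forms_induct) (auto intro: poly_funs.intros)

lemma forms_scale: "h \<in> forms I n \<Longrightarrow> h (\<lambda>i. s * x i) = s ^ n * h x"
  by (induction rule: forms_induct) (simp_all add: algebra_simps)

text \<open>Multiplying by powers of the coordinate sum, which is one, brings all terms to a common
  degree.\<close>

lemma poly_funs_form:
  assumes "f \<in> poly_funs I"
  shows "\<exists>n. \<exists>h \<in> forms I n. \<forall>x. (\<Sum>i \<in> I. x i) = 1 \<longrightarrow> h x = f x"
  using assms
proof (induction rule: poly_funs.induct)
  case (const c)
  show ?case by (intro exI[of _ 0] bexI[OF _ forms_const[of c I]]) simp
next
  case (coord i)
  have "(\<lambda>x. x i) \<in> forms I 1" using forms_coord[OF forms_const coord, of 1] by simp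
  then show ?case by (intro exI[of _ 1] bexI[where x = "\<lambda>x. x i"]) simp_all
next
  case (add f g)
  then obtain m n h h' where h: "h \<in> forms I m" "\<And>x. (\<Sum>i \<in> I. x i) = 1 \<Longrightarrow> h x = f x"
    and h': "h' \<in> forms I n" "\<And>x. (\<Sum>i \<in> I. x i) = 1 \<Longrightarrow> h' x = g x" by metis
  have \<sigma>: "(\<lambda>x. (\<Sum>i \<in> I. x i) ^ k) \<in> forms I k" for k
    using forms_power[OF forms_linear[of "\<lambda>_. 1" I], of k] by simp
  have "(\<lambda>x. (\<Sum>i \<in> I. x i) ^ n * h x) \<in> forms I (m + n)"
    using forms_mult[OF \<sigma> h(1), of n] by (simp add: add.commute)
  from forms_add[OF this forms_mult[OF \<sigma> h'(1), of m]] show ?case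
    by (intro exI[of _ "m + n"] bexI) (simp_all add: h(2) h'(2))
next
  case (mult f g)
  then obtain m n h h' where h: "h \<in> forms I m" "\<And>x. (\<Sum>i \<in> I. x i) = 1 \<Longrightarrow> h x = f x"
    and h': "h' \<in> forms I n" "\<And>x. (\<Sum>i \<in> I. x i) = 1 \<Longrightarrow> h' x = g x" by metis
  from forms_mult[OF h(1) h'(1)] show ?case
    by (intro exI[of _ "m + n"] bexI) (simp_all add: h(2) h'(2))
qed

lemma forms_pullback:
  assumes "finite J" "\<And>i. i \<in> I \<Longrightarrow> f i \<in> box_polys J D" "h \<in> forms I n"
  shows "(\<lambda>u. h (\<lambda>i. f i u)) \<in> box_polys J (n * D)"
  using assms(3)
proof (induction rule: forms_induct)
  case (coord h n i)
  then show ?case using box_polys_mult[OF assms(2)[OF coord(2)] coord(3)] by simp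
next
  case (add h n g)
  show ?case by (rule box_polys_add[OF add(3,4)])
qed (simp_all add: box_polys.zero box_polys_const[OF assms(1)])

lemma poly_funs_compose:
  "g \<in> poly_funs I \<Longrightarrow> (\<And>i. i \<in> I \<Longrightarrow> f i \<in> poly_funs J) \<Longrightarrow> (\<lambda>u. g (\<lambda>i. f i u)) \<in> poly_funs J"
  by (induction rule: poly_funs.induct) (auto intro: poly_funs.intros)

text \<open>A linear combination of the monomials in the \<open>h l\<close> with exponents at most \<open>k\<close>, made homogeneous by
  powers of \<open>h0\<close>. With \<open>h0\<close> of constant value one this is a polynomial relation between the \<open>h l\<close>;
  in general it is a relation between the quotients \<open>h l / h0\<close>.\<close>

definition form_combination ::
  "'l set \<Rightarrow> nat \<Rightarrow> ('x \<Rightarrow> complex) \<Rightarrow> ('l \<Rightarrow> 'x \<Rightarrow> complex) \<Rightarrow> (('l \<Rightarrow> nat) \<Rightarrow> complex) \<Rightarrow> 'x \<Rightarrow> complex"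
  where "form_combination L k h0 h c x =
    (\<Sum>a \<in> L \<rightarrow>\<^sub>E {..k}. c a * (h0 x ^ (k * card L - sum a L) * (\<Prod>l \<in> L. h l x ^ a l)))"

lemma sum_PiE_le:
  assumes "a \<in> L \<rightarrow>\<^sub>E {..k}"
  shows "sum a L \<le> k * card L"
  using sum_bounded_above[of L a k] assms by (fastforce simp: PiE_iff mult.commute)

lemma monomial_in_forms:
  assumes "finite L" "h0 \<in> forms I e" "\<And>l. l \<in> L \<Longrightarrow> h l \<in> forms I e" "a \<in> L \<rightarrow>\<^sub>E {..k}"
  shows "(\<lambda>x. h0 x ^ (k * card L - sum a L) * (\<Prod>l \<in> L. h l x ^ a l)) \<in> forms I (e * (k * card L))"
proof -
  have "e * (k * card L) = e * (k * card L - sum a L) + e * sum a L"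
    using sum_PiE_le[OF assms(4)] by (simp flip: distrib_left)
  moreover have "(\<lambda>x. h0 x ^ (k * card L - sum a L) * (\<Prod>l \<in> L. h l x ^ a l)) \<in>
      forms I (e * (k * card L - sum a L) + e * sum a L)"
    using forms_mult[OF forms_power[OF assms(2)] forms_prod_power[OF assms(1,3)]] .
  ultimately show ?thesis by simp
qed

lemma form_combination_in_forms:
  assumes "finite L" "h0 \<in> forms I e" "\<And>l. l \<in> L \<Longrightarrow> h l \<in> forms I e"
  shows "form_combination L k h0 h c \<in> forms I (e * (k * card L))"
  unfolding form_combination_def[abs_def]
  by (rule forms_sum) (rule forms_cmult, rule monomial_in_forms[OF assms])

section \<open>Normalized parametrized sets\<close>

definition normalized_image ::
  "'i set \<Rightarrow> 'j set \<Rightarrow> ('i \<Rightarrow> ('j \<Rightarrow> complex) \<Rightarrow> complex) \<Rightarrow> ('i \<Rightarrow> complex) set" where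
  "normalized_image I J f = (\<lambda>u. \<lambda>i \<in> I. f i u / (\<Sum>i \<in> I. f i u)) ` orthant J"

text \<open>The models and their mixtures, and the members of the chains that compute their dimension, all
  have this shape: a polynomial map on the positive orthant, divided by the sum of its
  coordinates.\<close>

locale parametrization =
  fixes I :: "'i set" and J :: "'j set" and f :: "'i \<Rightarrow> ('j \<Rightarrow> complex) \<Rightarrow> complex"
  assumes finite_I: "finite I" and finite_J: "finite J"
    and poly: "\<And>i. i \<in> I \<Longrightarrow> f i \<in> poly_funs J"
    and sum_nonzero: "\<And>u. u \<in> orthant J \<Longrightarrow> (\<Sum>i \<in> I. f i u) \<noteq> 0"
begin

abbreviation "image_closure \<equiv> zariski_topology I closure_of normalized_image I J f"

lemma image_affine: "normalized_image I J f \<subseteq> affine_space I"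
  by (auto simp: normalized_image_def affine_space_def)

lemma in_image_closure_iff:
  "x \<in> image_closure \<longleftrightarrow> x \<in> affine_space I \<and>
    (\<forall>g \<in> poly_funs I. (\<forall>y \<in> normalized_image I J f. g y = 0) \<longrightarrow> g x = 0)"
  by (rule in_closure_iff[OF image_affine])

lemma vanishes_on_closure:
  assumes "g \<in> poly_funs I" "\<And>y. y \<in> normalized_image I J f \<Longrightarrow> g y = 0" "x \<in> image_closure"
  shows "g x = 0"
  using assms(3)[unfolded in_image_closure_iff] assms(1,2) by simp

lemma image_in_closure: "normalized_image I J f \<subseteq> image_closure"
  using image_affine by (intro closure_of_subset) simp

lemma closure_affine: "image_closure \<subseteq> affine_space I"
  using closure_of_subset_topspace[of "zariski_topology I"] by simp

lemma sum_one_image: "x \<in> normalized_image I J f \<Longrightarrow> (\<Sum>i \<in> I. x i) = 1"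
  using sum_nonzero by (auto simp: normalized_image_def simp flip: sum_divide_distrib)

lemma sum_one_closure:
  assumes "x \<in> image_closure"
  shows "(\<Sum>i \<in> I. x i) = 1"
proof -
  have "(\<lambda>x. (\<Sum>i \<in> I. x i) + (- 1)) \<in> poly_funs I"
    by (rule poly_funs.add[OF poly_funs_sum[OF poly_funs.coord] poly_funs.const])
  then have "(\<Sum>i \<in> I. x i) + (- 1) = 0"
    by (rule vanishes_on_closure) (simp_all add: sum_one_image assms)
  then show ?thesis by simp
qed

lemma form_on_image:
  assumes "h \<in> forms I n"
  shows "h (\<lambda>i \<in> I. f i u / (\<Sum>i \<in> I. f i u)) = h (\<lambda>i. f i u) / (\<Sum>i \<in> I. f i u) ^ n"
proof -
  let ?s = "1 / (\<Sum>i \<in> I. f i u)"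
  have "h (\<lambda>i \<in> I. f i u / (\<Sum>i \<in> I. f i u)) = h (\<lambda>i. ?s * f i u)"
    by (rule poly_funs_cong[OF forms_poly[OF assms]]) simp
  also have "\<dots> = ?s ^ n * h (\<lambda>i. f i u)" by (rule forms_scale[OF assms])
  finally show ?thesis by (simp add: power_divide)
qed

lemma form_vanishes_on_image_iff:
  assumes "h \<in> forms I n"
  shows "(\<forall>x \<in> normalized_image I J f. h x = 0) \<longleftrightarrow> (\<forall>u \<in> orthant J. h (\<lambda>i. f i u) = 0)"
  unfolding normalized_image_def using form_on_image[OF assms] sum_nonzero by simp

text \<open>A product of two forms vanishing on the image pulls back to a product of polynomial functions
  vanishing on the orthant, where one of the factors must vanish.\<close>

lemma irreducible_closure:
  "irreducible_space (subtopology (zariski_topology I) image_closure)"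
  unfolding irreducible_iff[OF closure_affine]
proof (intro conjI ballI impI)
  have "(\<lambda>_. 1) \<in> orthant J" by (simp add: orthant_def)
  then have "normalized_image I J f \<noteq> {}" by (auto simp: normalized_image_def)
  then show "image_closure \<noteq> {}" using image_in_closure by blast
next
  fix g1 g2 assume g: "g1 \<in> poly_funs I" "g2 \<in> poly_funs I"
    and 0: "\<forall>x \<in> image_closure. g1 x * g2 x = 0"
  obtain n1 h1 where h1: "h1 \<in> forms I n1" "\<And>x. (\<Sum>i \<in> I. x i) = 1 \<Longrightarrow> h1 x = g1 x"
    using poly_funs_form[OF g(1)] by blast
  obtain n2 h2 where h2: "h2 \<in> forms I n2" "\<And>x. (\<Sum>i \<in> I. x i) = 1 \<Longrightarrow> h2 x = g2 x"
    using poly_funs_form[OF g(2)] by blast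
  have "\<forall>x \<in> normalized_image I J f. h1 x * h2 x = 0"
    using h1(2) h2(2) 0 sum_one_image image_in_closure by auto
  then have "\<forall>u \<in> orthant J. h1 (\<lambda>i. f i u) * h2 (\<lambda>i. f i u) = 0"
    using form_vanishes_on_image_iff[OF forms_mult[OF h1(1) h2(1)]] by simp
  then have "(\<forall>u \<in> orthant J. h1 (\<lambda>i. f i u) = 0) \<or> (\<forall>u \<in> orthant J. h2 (\<lambda>i. f i u) = 0)"
    by (intro orthant_domain poly_funs_compose[OF forms_poly[OF h1(1)] poly]
        poly_funs_compose[OF forms_poly[OF h2(1)] poly]) auto
  then have "(\<forall>x \<in> normalized_image I J f. g1 x = 0) \<or> (\<forall>x \<in> normalized_image I J f. g2 x = 0)"
    using form_vanishes_on_image_iff[OF h1(1)] form_vanishes_on_image_iff[OF h2(1)]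
      h1(2) h2(2) sum_one_image by auto
  then show "(\<forall>x \<in> image_closure. g1 x = 0) \<or> (\<forall>x \<in> image_closure. g2 x = 0)"
    using vanishes_on_closure[OF g(1)] vanishes_on_closure[OF g(2)] by metis
qed

text \<open>There are \<open>(k + 1) ^ card L\<close> monomials in the \<open>h l\<close>, while their pullbacks have degree at most a constant times \<open>k\<close> in each of the \<open>card J\<close>
  parameters, so they live in a space whose dimension grows only like \<open>k ^ card J\<close>.\<close>

lemma forms_dependent:
  assumes L: "finite L" "card J < card L"
    and h: "h0 \<in> forms I e" "\<And>l. l \<in> L \<Longrightarrow> h l \<in> forms I e"
  shows "\<exists>k c. (\<exists>a \<in> L \<rightarrow>\<^sub>E {..k}. c a \<noteq> 0) \<and>
    (\<forall>x \<in> image_closure. form_combination L k h0 h c x = 0)"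
proof -
  obtain D where D: "\<And>i. i \<in> I \<Longrightarrow> f i \<in> box_polys J D"
  proof -
    have "\<forall>i \<in> I. \<exists>D. f i \<in> box_polys J D"
      by (intro ballI poly_funs_box[OF finite_J] poly)
    from bchoice[OF this] obtain d where d: "\<forall>i \<in> I. f i \<in> box_polys J (d i)" ..
    have "f i \<in> box_polys J (sum d I)" if "i \<in> I" for i
      by (rule box_polys_mono[OF bspec[OF d that]]) (use member_le_sum[OF that, of d] finite_I in simp)
    from that[OF this] show ?thesis .
  qed
  \<comment> \<open>The space of pullbacks has dimension at most \<open>(C (k + 1)) ^ card J\<close>, so any \<open>k\<close> with
    \<open>C ^ card J < k + 1\<close> is large enough.\<close>
  define C where "C = e * card L * D + 1"
  define k where "k = C ^ card J"
  let ?n = "e * (k * card L) * D"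
  let ?A = "L \<rightarrow>\<^sub>E {..k}" and ?B = "J \<rightarrow>\<^sub>E {..?n}"
  let ?H = "\<lambda>a x. h0 x ^ (k * card L - sum a L) * (\<Prod>l \<in> L. h l x ^ a l)"
  have "\<forall>a \<in> ?A. \<exists>M. \<forall>u. ?H a (\<lambda>i. f i u) = (\<Sum>e \<in> ?B. M e * (\<Prod>j \<in> J. u j ^ e j))"
    by (intro ballI box_polys_coeffs[OF finite_J]
        forms_pullback[OF finite_J D monomial_in_forms[OF L(1) h]])
  from bchoice[OF this] obtain M where M: "\<forall>a \<in> ?A. \<forall>u.
      ?H a (\<lambda>i. f i u) = (\<Sum>e \<in> ?B. M a e * (\<Prod>j \<in> J. u j ^ e j))" ..
  have "card ?B = (?n + 1) ^ card J" using finite_J by (simp add: card_PiE)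
  also have "\<dots> \<le> (C * (k + 1)) ^ card J"
    unfolding C_def by (intro power_mono) (auto simp: algebra_simps)
  also have "\<dots> = k * (k + 1) ^ card J" 
    unfolding power_mult_distrib by (simp add: k_def)
  also have "\<dots> < (k + 1) * (k + 1) ^ card J" by simp
  also have "\<dots> = (k + 1) ^ Suc (card J)" by simp
  also have "\<dots> \<le> (k + 1) ^ card L" using L(2) by (intro power_increasing) auto
  also have "\<dots> = card ?A" using L(1) by (simp add: card_PiE)
  finally have "card ?B < card ?A" .
  then obtain c where c: "\<exists>a \<in> ?A. c a \<noteq> 0" "\<And>e. e \<in> ?B \<Longrightarrow> (\<Sum>a \<in> ?A. c a * M a e) = 0"
    using nontrivial_relation[of ?B ?A M] L(1) finite_J by (auto simp: finite_PiE)
  have "form_combination L k h0 h c (\<lambda>i. f i u) = 0" for u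
  proof -
    have "form_combination L k h0 h c (\<lambda>i. f i u) =
      (\<Sum>a \<in> ?A. \<Sum>e \<in> ?B. c a * (M a e * (\<Prod>j \<in> J. u j ^ e j)))"
      unfolding form_combination_def by (intro sum.cong refl) (simp add: M sum_distrib_left)
    also have "\<dots> = (\<Sum>e \<in> ?B. (\<Sum>a \<in> ?A. c a * M a e) * (\<Prod>j \<in> J. u j ^ e j))"
      by (subst sum.swap) (simp add: sum_distrib_right mult.assoc)
    finally show ?thesis using c(2) by simp
  qed
  moreover have form: "form_combination L k h0 h c \<in> forms I (e * (k * card L))"
    by (rule form_combination_in_forms) (fact L(1), fact h(1), fact h(2))
  ultimately have "\<forall>x \<in> normalized_image I J f. form_combination L k h0 h c x = 0"
    unfolding form_vanishes_on_image_iff[OF form] by blast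
  then have "\<forall>x \<in> image_closure. form_combination L k h0 h c x = 0"
    using vanishes_on_closure[OF forms_poly[OF form]] by simp
  then show ?thesis using c(1) by blast
qed

end

section \<open>Chains of irreducible closed sets\<close>

text \<open>Functions \<open>q j\<close> that vanish on \<open>Z j\<close> but not on the next member of a chain of irreducible sets
  are algebraically independent on its last member. In a relation on \<open>Z (Suc l)\<close>, expanded in powers
  of \<open>q l\<close>, the lowest coefficient can be isolated: the power of \<open>q l\<close> in front of it cancels since
  the set is irreducible, and on \<open>Z l\<close> all other terms vanish. It is a relation between the earlier
  functions.\<close>

lemma chain_independent:
  fixes Z :: "nat \<Rightarrow> ('i \<Rightarrow> complex) set"
  assumes nonempty: "Z 0 \<noteq> {}"
    and mono: "\<And>j. j < m \<Longrightarrow> Z j \<subseteq> Z (Suc j)"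
    and domain: "\<And>j g h. j \<le> m \<Longrightarrow> g \<in> poly_funs I \<Longrightarrow> h \<in> poly_funs I \<Longrightarrow>
      (\<And>x. x \<in> Z j \<Longrightarrow> g x * h x = 0) \<Longrightarrow> (\<forall>x \<in> Z j. g x = 0) \<or> (\<forall>x \<in> Z j. h x = 0)"
    and q: "\<And>j. j < m \<Longrightarrow> q j \<in> poly_funs I"
      "\<And>j x. j < m \<Longrightarrow> x \<in> Z j \<Longrightarrow> q j x = 0"
      "\<And>j. j < m \<Longrightarrow> \<exists>x \<in> Z (Suc j). q j x \<noteq> 0"
    and l: "l \<le> m"
    and zero: "\<And>x. x \<in> Z l \<Longrightarrow> (\<Sum>a \<in> {..<l} \<rightarrow>\<^sub>E {..k}. c a * (\<Prod>j<l. q j x ^ a j)) = 0"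
    and a: "a \<in> {..<l} \<rightarrow>\<^sub>E {..k}"
  shows "c a = 0"
  using l zero a
proof (induction l arbitrary: c a)
  case 0
  then show ?case using nonempty by auto
next
  case (Suc l)
  let ?G = "\<lambda>b x. \<Sum>a \<in> {..<l} \<rightarrow>\<^sub>E {..k}. c (a(l := b)) * (\<Prod>j<l. q j x ^ a j)"
  have Gpoly: "?G b \<in> poly_funs I" for b
    using Suc.prems(1)
    by (intro poly_funs_sum poly_funs_cmult poly_funs_prod poly_funs_power) (simp add: q(1))
  have expand: "(\<Sum>b\<le>k. q l x ^ b * ?G b x) = 0" if x: "x \<in> Z (Suc l)" for x
  proof -
    have "0 = (\<Sum>a \<in> insert l {..<l} \<rightarrow>\<^sub>E {..k}. c a * (\<Prod>j<Suc l. q j x ^ a j))"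
      using Suc.prems(2)[OF x] by (simp add: lessThan_Suc)
    also have "\<dots> = (\<Sum>b\<le>k. \<Sum>a \<in> {..<l} \<rightarrow>\<^sub>E {..k}. c (a(l := b)) *
        (\<Prod>j<Suc l. q j x ^ (a(l := b)) j))"
      by (rule sum_PiE_insert) simp
    also have "\<dots> = (\<Sum>b\<le>k. q l x ^ b * ?G b x)"
    proof (intro sum.cong refl)
      fix b
      have "(\<Prod>j<Suc l. q j x ^ (a(l := b)) j) = (\<Prod>j<l. q j x ^ a j) * q l x ^ b"
        for a :: "nat \<Rightarrow> nat"
        unfolding prod.lessThan_Suc by (intro arg_cong2[of _ _ _ _ "(*)"] prod.cong) auto
      then show "(\<Sum>a \<in> {..<l} \<rightarrow>\<^sub>E {..k}. c (a(l := b)) *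
          (\<Prod>j<Suc l. q j x ^ (a(l := b)) j)) = q l x ^ b * ?G b x"
        by (simp add: sum_distrib_left algebra_simps)
    qed
    finally show ?thesis by simp
  qed
  have coeffs: "\<forall>a \<in> {..<l} \<rightarrow>\<^sub>E {..k}. c (a(l := b)) = 0" if b: "b \<le> k" for b
    using b
  proof (induction b rule: less_induct)
    case (less b)
    \<comment> \<open>The relation with the power \<open>q l x ^ b\<close> cancelled; on \<open>Z l\<close> only its constant term survives.\<close>
    let ?S = "\<lambda>x. \<Sum>b'\<in>{b..k}. q l x ^ (b' - b) * ?G b' x"
    have Spoly: "?S \<in> poly_funs I"
      using Suc.prems(1) by (intro poly_funs_sum poly_funs.mult poly_funs_power Gpoly q(1)) simp
    have "q l x ^ b * ?S x = 0" if x: "x \<in> Z (Suc l)" for x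
    proof -
      have "?G b' x = 0" if "b' < b" for b'
      proof (intro sum.neutral ballI)
        fix a assume a: "a \<in> {..<l} \<rightarrow>\<^sub>E {..k}"
        have "b' \<le> k" using that less.prems by simp
        from bspec[OF less.IH[OF that this] a]
        show "c (a(l := b')) * (\<Prod>j<l. q j x ^ a j) = 0" by (simp only: mult_zero_left)
      qed
      then have "(\<Sum>b'\<le>k. q l x ^ b' * ?G b' x) = (\<Sum>b'\<in>{b..k}. q l x ^ b' * ?G b' x)"
        by (intro sum.mono_neutral_right) auto
      also have "\<dots> = (\<Sum>b'\<in>{b..k}. q l x ^ b * (q l x ^ (b' - b) * ?G b' x))"
      proof (intro sum.cong refl)
        fix b' assume "b' \<in> {b..k}"
        then have "q l x ^ b' = q l x ^ b * q l x ^ (b' - b)" by (simp flip: power_add)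
        then show "q l x ^ b' * ?G b' x = q l x ^ b * (q l x ^ (b' - b) * ?G b' x)"
          by (simp only: mult.assoc)
      qed
      also have "\<dots> = q l x ^ b * ?S x" by (rule sum_distrib_left[symmetric])
      finally show ?thesis using expand[OF x] by simp
    qed
    then have "(\<forall>x \<in> Z (Suc l). q l x ^ b = 0) \<or> (\<forall>x \<in> Z (Suc l). ?S x = 0)"
      using Suc.prems(1) by (intro domain[OF _ poly_funs_power[OF q(1)] Spoly]) auto
    moreover have "\<exists>x \<in> Z (Suc l). q l x ^ b \<noteq> 0" using q(3)[of l] Suc.prems(1) by auto
    ultimately have S0: "\<forall>x \<in> Z (Suc l). ?S x = 0" by blast
    have "?G b x = 0" if x: "x \<in> Z l" for x
    proof -
      have "q l x = 0" using q(2) x Suc.prems(1) by simp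
      then have "?S x = (\<Sum>b'\<in>{b..k}. if b' = b then ?G b x else 0)"
        by (intro sum.cong) (auto simp: power_0_left)
      also have "\<dots> = ?G b x" using less.prems by simp
      finally show ?thesis using S0 mono[of l] x Suc.prems(1) by auto
    qed
    then have "c (a(l := b)) = 0" if "a \<in> {..<l} \<rightarrow>\<^sub>E {..k}" for a
      using Suc.IH[of "\<lambda>a. c (a(l := b))" a] Suc.prems(1) that by simp
    then show ?case by blast
  qed
  have "a \<in> insert l {..<l} \<rightarrow>\<^sub>E {..k}" using Suc.prems(3) by (simp add: lessThan_Suc)
  then obtain b a' where a: "a = a'(l := b)" "b \<le> k" "a' \<in> {..<l} \<rightarrow>\<^sub>E {..k}"
    unfolding PiE_insert_eq by auto
  show ?case unfolding a(1) by (rule bspec[OF coeffs[OF a(2)] a(3)])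
qed

text \<open>The independent functions attached to a chain cannot outnumber the parameters.\<close>

lemma (in parametrization) chain_length_le:
  assumes closed: "\<And>j. j \<le> m \<Longrightarrow> closedin (zariski_topology I) (Z j)"
    and sub: "\<And>j. j \<le> m \<Longrightarrow> Z j \<subseteq> image_closure"
    and irred: "\<And>j. j \<le> m \<Longrightarrow> irreducible_space (subtopology (zariski_topology I) (Z j))"
    and strict: "\<And>j. j < m \<Longrightarrow> Z j \<subset> Z (Suc j)"
  shows "m \<le> card J"
proof (rule ccontr)
  assume "\<not> m \<le> card J"
  then have m: "card J < card {..<m}" by simp
  have aff: "Z j \<subseteq> affine_space I" if "j \<le> m" for j
    using closedin_subset[OF closed[OF that]] by simp
  have "\<exists>q \<in> poly_funs I. (\<forall>x \<in> Z j. q x = 0) \<and> (\<exists>x \<in> Z (Suc j). q x \<noteq> 0)" if j: "j < m" for j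
  proof -
    obtain P where P: "P \<subseteq> poly_funs I" "Z j = zero_set I P"
      using closed[of j] j unfolding closedin_zariski by auto
    obtain x where x: "x \<in> Z (Suc j)" "x \<notin> Z j" using strict[OF j] by blast
    then obtain q where "q \<in> P" "q x \<noteq> 0"
      using aff[of "Suc j"] j P(2) unfolding zero_set_def by auto
    then show ?thesis using P x unfolding zero_set_def by (intro bexI[of _ q]) auto
  qed
  then have "\<forall>j \<in> {..<m}. \<exists>q. q \<in> poly_funs I \<and> (\<forall>x \<in> Z j. q x = 0) \<and> (\<exists>x \<in> Z (Suc j). q x \<noteq> 0)"
    by (auto simp: Bex_def)
  from bchoice[OF this] obtain q where q: "\<forall>j \<in> {..<m}. q j \<in> poly_funs I \<and>
    (\<forall>x \<in> Z j. q j x = 0) \<and> (\<exists>x \<in> Z (Suc j). q j x \<noteq> 0)" ..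
  have "\<forall>j \<in> {..<m}. \<exists>n. \<exists>h \<in> forms I n. \<forall>x. (\<Sum>i \<in> I. x i) = 1 \<longrightarrow> h x = q j x"
    using q by (intro ballI poly_funs_form) blast
  from bchoice[OF this] obtain n where
    "\<forall>j \<in> {..<m}. \<exists>h. h \<in> forms I (n j) \<and> (\<forall>x. (\<Sum>i \<in> I. x i) = 1 \<longrightarrow> h x = q j x)"
    by (auto simp: Bex_def)
  from bchoice[OF this] obtain h where
    h: "\<forall>j \<in> {..<m}. h j \<in> forms I (n j) \<and> (\<forall>x. (\<Sum>i \<in> I. x i) = 1 \<longrightarrow> h j x = q j x)" ..
  \<comment> \<open>A common degree for all the forms, reached by multiplication with powers of the coordinate sum.\<close>
  define e where "e = sum n {..<m}"
  define \<sigma> :: "('i \<Rightarrow> complex) \<Rightarrow> complex" where "\<sigma> x = (\<Sum>i \<in> I. x i)" for x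
  have \<sigma>: "(\<lambda>x. \<sigma> x ^ k) \<in> forms I k" for k
    using forms_power[OF forms_linear[of "\<lambda>_. 1" I], of k] by (simp add: \<sigma>_def)
  have h': "(\<lambda>x. \<sigma> x ^ (e - n j) * h j x) \<in> forms I e" if "j \<in> {..<m}" for j
  proof -
    have "n j \<le> e" unfolding e_def using that by (intro member_le_sum) auto
    moreover have "h j \<in> forms I (n j)" using h that by blast
    ultimately show ?thesis using forms_mult[OF \<sigma>, of "h j" "n j" "e - n j"] by simp
  qed
  obtain k c where c: "\<exists>a \<in> {..<m} \<rightarrow>\<^sub>E {..k}. c a \<noteq> 0"
    and 0: "\<forall>x \<in> image_closure. form_combination {..<m} k (\<lambda>x. \<sigma> x ^ e)
      (\<lambda>j x. \<sigma> x ^ (e - n j) * h j x) c x = 0"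
    
    using forms_dependent[of "{..<m}" "\<lambda>x. \<sigma> x ^ e" e "\<lambda>j x. \<sigma> x ^ (e - n j) * h j x"]
      m \<sigma> h' by auto
  have zero: "(\<Sum>a \<in> {..<m} \<rightarrow>\<^sub>E {..k}. c a * (\<Prod>j<m. q j x ^ a j)) = 0" if "x \<in> Z m" for x
  proof -
    have x: "x \<in> image_closure" using sub[of m] that by blast
    have s: "\<sigma> x = 1" using sum_one_closure[OF x] by (simp add: \<sigma>_def)
    then have "h j x = q j x" if "j < m" for j using h that by (simp add: \<sigma>_def)
    then have "(\<Sum>a \<in> {..<m} \<rightarrow>\<^sub>E {..k}. c a * (\<Prod>j<m. q j x ^ a j)) =
      form_combination {..<m} k (\<lambda>x. \<sigma> x ^ e) (\<lambda>j x. \<sigma> x ^ (e - n j) * h j x) c x"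
      unfolding form_combination_def s by simp
    then show ?thesis using 0 x by simp
  qed
  have irred': "Z j \<noteq> {} \<and> (\<forall>f \<in> poly_funs I. \<forall>g \<in> poly_funs I. (\<forall>x \<in> Z j. f x * g x = 0) \<longrightarrow>
      (\<forall>x \<in> Z j. f x = 0) \<or> (\<forall>x \<in> Z j. g x = 0))" if "j \<le> m" for j
    using irred[OF that] unfolding irreducible_iff[OF aff[OF that]] .
  have "c a = 0" if "a \<in> {..<m} \<rightarrow>\<^sub>E {..k}" for a
  proof (rule chain_independent[where Z = Z and m = m and I = I and q = q and l = m and k = k
        and c = c and a = a])
    show "Z 0 \<noteq> {}" using irred'[of 0] by simp
    show "(\<forall>x \<in> Z j. g x = 0) \<or> (\<forall>x \<in> Z j. h x = 0)"
      if "j \<le> m" "g \<in> poly_funs I" "h \<in> poly_funs I" "\<And>x. x \<in> Z j \<Longrightarrow> g x * h x = 0" for j g h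
      using irred'[OF that(1)] that(2-4) by simp
  qed (use q strict zero that in auto)
  then show False using c by blast
qed

section \<open>Independence from the Jacobian\<close>

text \<open>Adding a vector \<open>w b\<close> to an independent family: subtracting from it its components along the
  others, as read off by the dual family at hand, leaves a nonzero vector. A coordinate where that
  vector is nonzero, corrected to kill the others, is the new functional.\<close>

lemma dual_family:
  fixes w :: "'b \<Rightarrow> 'i \<Rightarrow> complex"
  assumes "finite B" "finite I"
    and "\<And>c. (\<forall>i \<in> I. (\<Sum>b \<in> B. c b * w b i) = 0) \<Longrightarrow> \<forall>b \<in> B. c b = 0"
  shows "\<exists>z. \<forall>b \<in> B. \<forall>b' \<in> B. (\<Sum>i \<in> I. z b i * w b' i) = (if b = b' then 1 else 0)"
  using assms(1,3)
proof (induction B rule: finite_induct)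
  case (insert b B)
  have "\<forall>b' \<in> B. c b' = 0" if "\<forall>i \<in> I. (\<Sum>b \<in> B. c b * w b i) = 0" for c
  proof -
    have "(\<Sum>b' \<in> insert b B. (c(b := 0)) b' * w b' i) = (\<Sum>b \<in> B. c b * w b i)" for i
      using insert.hyps by (simp, intro sum.cong) auto
    then have z: "\<forall>b' \<in> insert b B. (c(b := 0)) b' = 0"
      using that by (intro insert.prems) simp
    show ?thesis
    proof
      fix b' assume "b' \<in> B"
      then show "c b' = 0" using bspec[OF z, of b'] insert.hyps by (cases "b' = b") auto
    qed
  qed
  then obtain z where z: "\<forall>b \<in> B. \<forall>b' \<in> B. (\<Sum>i \<in> I. z b i * w b' i) = (if b = b' then 1 else 0)"
    using insert.IH by blast
  let ?p = "\<lambda>b' y. \<Sum>i \<in> I. z b' i * y i"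
  let ?w = "\<lambda>i. w b i - (\<Sum>b' \<in> B. ?p b' (w b) * w b' i)"
  have "\<exists>i0 \<in> I. ?w i0 \<noteq> 0"
  proof (rule ccontr)
    assume neg: "\<not> (\<exists>i0 \<in> I. ?w i0 \<noteq> 0)"
    let ?c = "\<lambda>b'. if b' = b then 1 else - ?p b' (w b)"
    have "(\<Sum>b' \<in> insert b B. ?c b' * w b' i) = ?w i" for i
    proof -
      have "(\<Sum>b' \<in> B. ?c b' * w b' i) = (\<Sum>b' \<in> B. - (?p b' (w b) * w b' i))"
        using insert.hyps by (intro sum.cong) auto
      then show ?thesis using insert.hyps by (simp add: sum_negf)
    qed
    then have "\<forall>b' \<in> insert b B. ?c b' = 0" using neg by (intro insert.prems) simp
    then show False by simp
  qed
  then obtain i0 where i0: "i0 \<in> I" "?w i0 \<noteq> 0" by blast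
  define y where "y i = ((if i = i0 then 1 else 0) - (\<Sum>b' \<in> B. w b' i0 * z b' i)) / ?w i0" for i
  have y: "(\<Sum>i \<in> I. y i * v i) = (v i0 - (\<Sum>b' \<in> B. w b' i0 * ?p b' v)) / ?w i0" for v
  proof -
    have "(\<Sum>i \<in> I. y i * v i) =
      ((\<Sum>i \<in> I. if i = i0 then v i else 0) - (\<Sum>i \<in> I. \<Sum>b' \<in> B. w b' i0 * (z b' i * v i))) / ?w i0"
      unfolding y_def sum_subtractf[symmetric] sum_divide_distrib
      by (intro sum.cong refl)
        (simp add: left_diff_distrib sum_distrib_right diff_divide_distrib mult.assoc)
    also have "(\<Sum>i \<in> I. \<Sum>b' \<in> B. w b' i0 * (z b' i * v i)) = (\<Sum>b' \<in> B. w b' i0 * ?p b' v)"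
      by (subst sum.swap) (simp add: sum_distrib_left)
    finally show ?thesis using i0 assms(2) by simp
  qed
  have yB: "(\<Sum>i \<in> I. y i * w b' i) = 0" if "b' \<in> B" for b'
  proof -
    have "(\<Sum>b'' \<in> B. w b'' i0 * ?p b'' (w b')) = (\<Sum>b'' \<in> B. if b'' = b' then w b'' i0 else 0)"
      using z that by (intro sum.cong) auto
    then show ?thesis unfolding y using that insert.hyps by simp
  qed
  have yb: "(\<Sum>i \<in> I. y i * w b i) = 1"
    unfolding y using i0(2) by (simp add: mult.commute)
  let ?z = "\<lambda>b'. if b' = b then y else (\<lambda>i. z b' i - ?p b' (w b) * y i)"
  have "(\<Sum>i \<in> I. ?z b1 i * w b2 i) = (if b1 = b2 then 1 else 0)"
    if b: "b1 \<in> insert b B" "b2 \<in> insert b B" for b1 b2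
  proof (cases "b1 = b")
    case True
    show ?thesis
    proof (cases "b2 = b")
      case False
      then show ?thesis using yB[of b2] b True by simp
    qed (use True yb in simp)
  next
    case False
    then have "(\<Sum>i \<in> I. ?z b1 i * w b2 i) = ?p b1 (w b2) - ?p b1 (w b) * (\<Sum>i \<in> I. y i * w b2 i)"
      by (simp add: left_diff_distrib sum_subtractf sum_distrib_left mult.assoc)
    note e = this
    have b1: "b1 \<in> B" using b False by simp
    show ?thesis
    proof (cases "b2 = b")
      case True
      then show ?thesis unfolding e using yb False by simp
    next
      case False
      then have "b2 \<in> B" using b by simp
      then show ?thesis unfolding e using yB[of b2] bspec[OF bspec[OF z b1], of b2] by simp
    qed
  qed
  then show ?case by (intro exI[of _ ?z] ballI)
qed simp

text \<open>The variables outside \<open>K\<close> are fixed at their values in \<open>w\<close>. Along an increasing sequence of sets \<open>K\<close>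
  the images form the chain that bounds the dimension from below.\<close>

definition freeze ::
  "'j set \<Rightarrow> ('j \<Rightarrow> complex) \<Rightarrow> ('i \<Rightarrow> ('j \<Rightarrow> complex) \<Rightarrow> complex) \<Rightarrow> 'i \<Rightarrow> ('j \<Rightarrow> complex) \<Rightarrow> complex"
  where "freeze K w f i u = f i (\<lambda>j. if j \<in> K then u j else w j)"

lemma (in parametrization) parametrization_freeze:
  assumes "w \<in> orthant J" "K \<subseteq> J"
  shows "parametrization I K (freeze K w f)"
proof
  show "finite K" using finite_subset[OF assms(2) finite_J] .
  show "freeze K w f i \<in> poly_funs K" if "i \<in> I" for i
    unfolding freeze_def[abs_def] by (rule poly_funs_specialize[OF poly[OF that]])
  show "(\<Sum>i \<in> I. freeze K w f i u) \<noteq> 0" if "u \<in> orthant K" for u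
    unfolding freeze_def using assms that by (intro sum_nonzero) (auto simp: orthant_def)
qed (rule finite_I)

lemma normalized_image_freeze_mono:
  assumes w: "w \<in> orthant J" and K: "K \<subseteq> K'" "K' \<subseteq> J"
  shows "normalized_image I K (freeze K w f) \<subseteq> normalized_image I K' (freeze K' w f)"
  unfolding normalized_image_def
proof (rule image_subsetI)
  fix u assume u: "u \<in> orthant K"
  let ?u = "\<lambda>j. if j \<in> K then u j else w j"
  have "(\<lambda>j. if j \<in> K' then ?u j else w j) = ?u" using K by (auto simp: fun_eq_iff)
  then have "freeze K w f i u = freeze K' w f i ?u" for i by (simp add: freeze_def)
  moreover have "?u \<in> orthant K'" using u w K by (auto simp: orthant_def)
  ultimately show "(\<lambda>i \<in> I. freeze K w f i u / (\<Sum>i \<in> I. freeze K w f i u)) \<in>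
      (\<lambda>u. \<lambda>i \<in> I. freeze K' w f i u / (\<Sum>i \<in> I. freeze K' w f i u)) ` orthant K'"
    by simp
qed

lemma (in parametrization) normalized_image_freeze_all:
  "normalized_image I J (freeze J w f) = normalized_image I J f"
proof -
  have "freeze J w f i u = f i u" if "i \<in> I" for i u
    unfolding freeze_def by (rule poly_funs_cong[OF poly[OF that]]) simp
  then show ?thesis by (auto simp: normalized_image_def cong: restrict_cong)
qed

text \<open>The matrix \<open>D\<close> is the Jacobian of \<open>f\<close> at \<open>w\<close>, and injectivity is asked for the cone over the image,
  that is for the Jacobian together with the vector \<open>f w\<close>: this is what survives the
  normalization.\<close>

locale immersion = parametrization +
  fixes w and D :: "'a \<Rightarrow> 'b \<Rightarrow> complex"
  assumes w: "w \<in> orthant J"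
    and derivative: "\<And>i v. i \<in> I \<Longrightarrow>
      ((\<lambda>s. f i (\<lambda>j. w j + s * v j)) has_field_derivative (\<Sum>j \<in> J. v j * D i j)) (at 0)"
    and injective: "\<And>c0 c. (\<And>i. i \<in> I \<Longrightarrow> c0 * f i w + (\<Sum>j \<in> J. c j * D i j) = 0) \<Longrightarrow>
      c0 = 0 \<and> (\<forall>j \<in> J. c j = 0)"
begin

lemma dual_forms:
  obtains z0 z where "(\<Sum>i \<in> I. z0 i * f i w) = 1"
    and "\<And>l. l \<in> J \<Longrightarrow> (\<Sum>i \<in> I. z l i * f i w) = 0"
    and "\<And>l j. l \<in> J \<Longrightarrow> j \<in> J \<Longrightarrow> (\<Sum>i \<in> I. z l i * D i j) = (if l = j then 1 else 0)"
proof -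
  let ?B = "insert None (Some ` J)"
  let ?y = "\<lambda>b i. case b of None \<Rightarrow> f i w | Some j \<Rightarrow> D i j"
  have "\<forall>b \<in> ?B. c b = 0" if c: "\<forall>i \<in> I. (\<Sum>b \<in> ?B. c b * ?y b i) = 0" for c
  proof -
    have "(\<Sum>b \<in> ?B. c b * ?y b i) = c None * f i w + (\<Sum>j \<in> J. c (Some j) * D i j)" for i
      using finite_J by (subst sum.insert) (auto simp: sum.reindex)
    then have "c None = 0 \<and> (\<forall>j \<in> J. c (Some j) = 0)"
      using c by (intro injective) simp
    then show ?thesis by auto
  qed
  then have "\<exists>z. \<forall>b \<in> ?B. \<forall>b' \<in> ?B. (\<Sum>i \<in> I. z b i * ?y b' i) = (if b = b' then 1 else 0)"
    using finite_J finite_I by (intro dual_family) auto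
  then obtain z where z: "\<forall>b \<in> ?B. \<forall>b' \<in> ?B. (\<Sum>i \<in> I. z b i * ?y b' i) = (if b = b' then 1 else 0)" ..
  show ?thesis
  proof (rule that[of "z None" "\<lambda>l. z (Some l)"])
    show "(\<Sum>i \<in> I. z None i * f i w) = 1"
      using bspec[OF bspec[OF z, of None], of None] by simp
    show "(\<Sum>i \<in> I. z (Some l) i * f i w) = 0" if "l \<in> J" for l
      using bspec[OF bspec[OF z, of "Some l"], of None] that by simp
    show "(\<Sum>i \<in> I. z (Some l) i * D i j) = (if l = j then 1 else 0)" if "l \<in> J" "j \<in> J" for l j
      using bspec[OF bspec[OF z, of "Some l"], of "Some j"] that by simp
  qed
qed

text \<open>The linear forms \<open>z0\<close> and \<open>z l\<close> are dual to \<open>f w\<close> and the columns of the Jacobian. Along the line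
  through \<open>w\<close> with direction \<open>v\<close>, after time \<open>s\<close>, they take the values \<open>1 + o(1)\<close> and
  \<open>s * v l + o(s)\<close>. So a relation of lowest degree \<open>d\<close> becomes, after division by \<open>s ^ d\<close> and
  passing to the limit, a polynomial identity in \<open>v\<close> whose coefficients are those of degree \<open>d\<close>.\<close>

lemma lowest_order_independence:
  assumes z0: "(\<Sum>i \<in> I. z0 i * f i w) = 1"
    and z: "\<And>l. l \<in> J \<Longrightarrow> (\<Sum>i \<in> I. z l i * f i w) = 0"
    and zD: "\<And>l j. l \<in> J \<Longrightarrow> j \<in> J \<Longrightarrow> (\<Sum>i \<in> I. z l i * D i j) = (if l = j then 1 else 0)"
    and K: "K \<subseteq> J"
    and zero: "\<And>u. u \<in> orthant K \<Longrightarrow> form_combination K k (\<lambda>x. \<Sum>i \<in> I. z0 i * x i)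
      (\<lambda>l x. \<Sum>i \<in> I. z l i * x i) c (\<lambda>i. freeze K w f i u) = 0"
    and a: "a \<in> K \<rightarrow>\<^sub>E {..k}"
  shows "c a = 0"
proof (rule ccontr)
  assume ne: "c a \<noteq> 0"
  have finK: "finite K" using finite_subset[OF K finite_J] .
  let ?A = "K \<rightarrow>\<^sub>E {..k}"
  let ?P = "\<lambda>n. \<exists>a \<in> ?A. c a \<noteq> 0 \<and> sum a K = n"
  define d where "d = (LEAST n. ?P n)"
  have "?P (sum a K)" using a ne by blast
  then have "?P d" unfolding d_def by (rule LeastI)
  then obtain b where b: "b \<in> ?A" "c b \<noteq> 0" "sum b K = d" by blast
  have low: "c a = 0" if "a \<in> ?A" "sum a K < d" for a
    using not_less_Least[of "sum a K" ?P] that unfolding d_def by blast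
  let ?c = "\<lambda>a. if sum a K = d then c a else 0"
  have "(\<Sum>a \<in> ?A. ?c a * (\<Prod>l \<in> K. complex_of_real (v l) ^ a l)) = 0" for v :: "'b \<Rightarrow> real"
  proof -
    define V where "V j = (if j \<in> K then complex_of_real (v j) else 0)" for j
    define \<Phi> where "\<Phi> y s = (\<Sum>i \<in> I. y i * f i (\<lambda>j. w j + s * V j))" for y s
    have \<Phi>0: "\<Phi> y 0 = (\<Sum>i \<in> I. y i * f i w)" for y by (simp add: \<Phi>_def)
    have der: "(\<Phi> y has_field_derivative (\<Sum>i \<in> I. y i * (\<Sum>j \<in> J. V j * D i j))) (at 0)" for y
      unfolding \<Phi>_def[abs_def] by (intro DERIV_sum DERIV_cmult derivative)
    have lim0: "filterlim complex_of_real (at 0) (at_right 0)"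
      by (rule filterlim_atI)
        (auto intro!: tendsto_eq_intros simp: eventually_at_filter)
    have T0: "((\<lambda>s. \<Phi> z0 (complex_of_real s)) \<longlongrightarrow> 1) (at_right 0)"
    proof -
      have "(\<Phi> z0 \<longlongrightarrow> 1) (at 0)" using DERIV_isCont[OF der[of z0]] \<Phi>0[of z0] z0
        by (simp add: isCont_def)
      then show ?thesis using filterlim_compose lim0 by blast
    qed
    have T: "((\<lambda>s. \<Phi> (z l) (complex_of_real s) / complex_of_real s) \<longlongrightarrow> V l) (at_right 0)"
      if l: "l \<in> K" for l
    proof -
      have lJ: "l \<in> J" using l K by blast
      have "(\<Sum>i \<in> I. z l i * (\<Sum>j \<in> J. V j * D i j)) = (\<Sum>j \<in> J. V j * (\<Sum>i \<in> I. z l i * D i j))"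
        unfolding sum_distrib_left by (subst sum.swap) (simp add: mult.left_commute)
      also have "\<dots> = (\<Sum>j \<in> J. if l = j then V j else 0)"
        using zD[OF lJ] by (intro sum.cong) auto
      also have "\<dots> = V l" using lJ finite_J by simp
      finally have "(\<Phi> (z l) has_field_derivative V l) (at 0)" using der[of "z l"] by simp
      then have "((\<lambda>s. \<Phi> (z l) s / s) \<longlongrightarrow> V l) (at 0)"
        using \<Phi>0[of "z l"] z[OF lJ] by (simp add: DERIV_def)
      then show ?thesis using filterlim_compose lim0 by blast
    qed
    let ?F = "\<lambda>s a. c a * (\<Phi> z0 (complex_of_real s) ^ (k * card K - sum a K) *
      (complex_of_real s ^ (sum a K - d) *
        (\<Prod>l \<in> K. (\<Phi> (z l) (complex_of_real s) / complex_of_real s) ^ a l)))"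
    have "((\<lambda>s. \<Sum>a \<in> ?A. ?F s a) \<longlongrightarrow>
        (\<Sum>a \<in> ?A. c a * (1 ^ (k * card K - sum a K) *
          (complex_of_real 0 ^ (sum a K - d) * (\<Prod>l \<in> K. V l ^ a l))))) (at_right 0)"
      by (intro tendsto_intros T0 T) auto
    also have "(\<Sum>a \<in> ?A. c a * (1 ^ (k * card K - sum a K) *
          (complex_of_real 0 ^ (sum a K - d) * (\<Prod>l \<in> K. V l ^ a l)))) =
        (\<Sum>a \<in> ?A. ?c a * (\<Prod>l \<in> K. complex_of_real (v l) ^ a l))"
    proof (intro sum.cong refl)
      fix a assume a: "a \<in> ?A"
      have "(\<Prod>l \<in> K. V l ^ a l) = (\<Prod>l \<in> K. complex_of_real (v l) ^ a l)"
        by (intro prod.cong) (auto simp: V_def)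
      then show "c a * (1 ^ (k * card K - sum a K) *
          (complex_of_real 0 ^ (sum a K - d) * (\<Prod>l \<in> K. V l ^ a l))) =
        ?c a * (\<Prod>l \<in> K. complex_of_real (v l) ^ a l)"
        using low[OF a] by (cases "sum a K" d rule: linorder_cases) auto
    qed
    finally have lim: "((\<lambda>s. \<Sum>a \<in> ?A. ?F s a) \<longlongrightarrow>
        (\<Sum>a \<in> ?A. ?c a * (\<Prod>l \<in> K. complex_of_real (v l) ^ a l))) (at_right 0)" .
    have "\<forall>\<^sub>F s in at_right 0. \<forall>j \<in> K. 0 < Re (w j) + s * v j"
    proof (intro eventually_ball_finite finK ballI)
      fix j assume "j \<in> K"
      then have "0 < Re (w j)" using w K by (auto simp: orthant_def)
      moreover have "((\<lambda>s. Re (w j) + s * v j) \<longlongrightarrow> Re (w j) + 0 * v j) (at_right 0)"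
        by (intro tendsto_intros)
      ultimately show "\<forall>\<^sub>F s in at_right 0. 0 < Re (w j) + s * v j"
        by (intro order_tendstoD(1)[where y = "Re (w j) + 0 * v j"]) auto
    qed
    then have "\<forall>\<^sub>F s in at_right 0. (\<Sum>a \<in> ?A. ?F s a) = 0"
      using eventually_at_right_less[of 0]
    proof eventually_elim
      fix s :: real assume pos: "\<forall>j \<in> K. 0 < Re (w j) + s * v j" and s: "0 < s"
      let ?u = "\<lambda>j. w j + complex_of_real s * V j"
      have "?u \<in> orthant K" using pos w K by (auto simp: orthant_def V_def)
      then have "form_combination K k (\<lambda>x. \<Sum>i \<in> I. z0 i * x i)
        (\<lambda>l x. \<Sum>i \<in> I. z l i * x i) c (\<lambda>i. freeze K w f i ?u) = 0" by (rule zero)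
      moreover have "(\<lambda>j. if j \<in> K then ?u j else w j) = ?u" by (auto simp: V_def)
      ultimately have "0 = (\<Sum>a \<in> ?A. c a * (\<Phi> z0 (complex_of_real s) ^ (k * card K - sum a K) *
          (\<Prod>l \<in> K. \<Phi> (z l) (complex_of_real s) ^ a l)))"
        by (simp add: form_combination_def freeze_def \<Phi>_def)
      also have "\<dots> = (\<Sum>a \<in> ?A. complex_of_real s ^ d * ?F s a)"
      proof (intro sum.cong refl)
        fix a assume a: "a \<in> ?A"
        have "(\<Prod>l \<in> K. \<Phi> (z l) (complex_of_real s) ^ a l) =
          (\<Prod>l \<in> K. complex_of_real s ^ a l * (\<Phi> (z l) (complex_of_real s) / complex_of_real s) ^ a l)"
          using s by (intro prod.cong refl) (simp add: power_divide)
        also have "\<dots> = complex_of_real s ^ sum a K *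
          (\<Prod>l \<in> K. (\<Phi> (z l) (complex_of_real s) / complex_of_real s) ^ a l)"
          by (simp add: prod.distrib power_sum)
        finally have e: "(\<Prod>l \<in> K. \<Phi> (z l) (complex_of_real s) ^ a l) = complex_of_real s ^ sum a K *
          (\<Prod>l \<in> K. (\<Phi> (z l) (complex_of_real s) / complex_of_real s) ^ a l)" .
        show "c a * (\<Phi> z0 (complex_of_real s) ^ (k * card K - sum a K) *
          (\<Prod>l \<in> K. \<Phi> (z l) (complex_of_real s) ^ a l)) = complex_of_real s ^ d * ?F s a"
        proof (cases "sum a K < d")
          case False
          then have "complex_of_real s ^ sum a K = complex_of_real s ^ d * complex_of_real s ^ (sum a K - d)"
            by (simp flip: power_add)
          then show ?thesis unfolding e by (simp only: ac_simps)
        qed (simp add: low[OF a])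
      qed
      also have "\<dots> = complex_of_real s ^ d * (\<Sum>a \<in> ?A. ?F s a)" by (rule sum_distrib_left[symmetric])
      finally show "(\<Sum>a \<in> ?A. ?F s a) = 0" using s by simp
    qed
    then have "((\<lambda>s. \<Sum>a \<in> ?A. ?F s a) \<longlongrightarrow> 0) (at_right 0)" by (rule tendsto_eventually)
    then show ?thesis using lim by (intro tendsto_unique[OF trivial_limit_at_right_real])
  qed
  from vanishing_poly_coeffs[OF finK this b(1)] show False using b by simp
qed

text \<open>There are too many of the dual forms for the smaller parameter set, so they satisfy a relation
  on its image; on the larger image they do not.\<close>

lemma closure_freeze_strict:
  assumes K: "K \<subset> K'" "K' \<subseteq> J"
  shows "zariski_topology I closure_of normalized_image I K (freeze K w f) \<subset>
    zariski_topology I closure_of normalized_image I K' (freeze K' w f)"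
proof -
  have KJ: "K \<subseteq> J" using K by blast
  interpret P: parametrization I K "freeze K w f" by (rule parametrization_freeze[OF w KJ])
  interpret P': parametrization I K' "freeze K' w f" by (rule parametrization_freeze[OF w K(2)])
  have "P.image_closure \<subseteq> P'.image_closure"
    using K by (intro closure_of_mono normalized_image_freeze_mono[OF w]) auto
  moreover have "P.image_closure \<noteq> P'.image_closure"
  proof
    assume eq: "P.image_closure = P'.image_closure"
    obtain z0 z where z: "(\<Sum>i \<in> I. z0 i * f i w) = 1"
      "\<And>l. l \<in> J \<Longrightarrow> (\<Sum>i \<in> I. z l i * f i w) = 0"
      "\<And>l j. l \<in> J \<Longrightarrow> j \<in> J \<Longrightarrow> (\<Sum>i \<in> I. z l i * D i j) = (if l = j then 1 else 0)"
      by (rule dual_forms) (rule that)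
    let ?head = "\<lambda>x. \<Sum>i \<in> I. z0 i * x i" and ?h = "\<lambda>l x. \<Sum>i \<in> I. z l i * x i"
    have "card K < card K'" using psubset_card_mono[OF P'.finite_J K(1)] .
    then obtain k c where c: "\<exists>a \<in> K' \<rightarrow>\<^sub>E {..k}. c a \<noteq> 0"
      and 0: "\<forall>x \<in> P.image_closure. form_combination K' k ?head ?h c x = 0"
      using P.forms_dependent[of K' ?head 1 ?h] P'.finite_J forms_linear[of z0 I] forms_linear[of _ I]
      by auto
    have form: "form_combination K' k ?head ?h c \<in> forms I (1 * (k * card K'))"
      by (rule form_combination_in_forms[OF P'.finite_J]) (rule forms_linear)+
    have "\<forall>x \<in> normalized_image I K' (freeze K' w f). form_combination K' k ?head ?h c x = 0"
      using 0 P'.image_in_closure unfolding eq by blast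
    then have zero: "\<forall>u \<in> orthant K'. form_combination K' k ?head ?h c (\<lambda>i. freeze K' w f i u) = 0"
      unfolding P'.form_vanishes_on_image_iff[OF form] .
    have "c a = 0" if "a \<in> K' \<rightarrow>\<^sub>E {..k}" for a
      by (rule lowest_order_independence[OF z K(2) bspec[OF zero] that])
    then show False using c by blast
  qed
  ultimately show ?thesis by blast
qed

text \<open>A flag of coordinate subspaces of the parameter space gives a chain of full length.\<close>

theorem model_dim_normalized_image: "model_dim I (normalized_image I J f) = enat (card J)"
proof -
  let ?T = "zariski_topology I"
  have closed: "closedin ?T image_closure" by simp
  have chain: "closedin (subtopology ?T image_closure) A \<and>
      irreducible_space (subtopology (subtopology ?T image_closure) A) \<longleftrightarrow>
      closedin ?T A \<and> A \<subseteq> image_closure \<and> irreducible_space (subtopology ?T A)" for A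
    unfolding closedin_closed_subtopology[OF closed] subtopology_subtopology
    by (metis inf.absorb_iff2)
  show ?thesis
    unfolding model_dim_def krull_dim_def chain
  proof (rule antisym)
    show "Sup {enat n |n. \<exists>Z. (\<forall>k\<le>n. closedin ?T (Z k) \<and> Z k \<subseteq> image_closure \<and>
        irreducible_space (subtopology ?T (Z k))) \<and> (\<forall>k<n. Z k \<subset> Z (Suc k))} \<le> enat (card J)"
    proof (rule Sup_least, clarify)
      fix n Z assume Z: "\<forall>k\<le>n. closedin ?T (Z k) \<and> Z k \<subseteq> image_closure \<and>
        irreducible_space (subtopology ?T (Z k))" "\<forall>k<n. Z k \<subset> Z (Suc k)"
      have "n \<le> card J" by (rule chain_length_le[of n Z]) (use Z in auto)
      then show "enat n \<le> enat (card J)" by simp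
    qed
    obtain g where g: "bij_betw g {0..<card J} J" using ex_bij_betw_nat_finite[OF finite_J] by blast
    let ?K = "\<lambda>l. g ` {0..<l}"
    let ?Z = "\<lambda>l. ?T closure_of normalized_image I (?K l) (freeze (?K l) w f)"
    have K: "?K l \<subseteq> J" if "l \<le> card J" for l
      using g that by (auto simp: bij_betw_def)
    have "?Z l \<subseteq> image_closure" if "l \<le> card J" for l
      using normalized_image_freeze_mono[OF w K[OF that] subset_refl, of I f]
      unfolding normalized_image_freeze_all by (rule closure_of_mono)
    moreover have "irreducible_space (subtopology ?T (?Z l))" if "l \<le> card J" for l
      by (rule parametrization.irreducible_closure[OF parametrization_freeze[OF w K[OF that]]])
    moreover have "?Z l \<subset> ?Z (Suc l)" if l: "l < card J" for l
    proof (rule closure_freeze_strict)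
      have "g l \<notin> ?K l" using g l by (auto simp: bij_betw_def dest!: inj_onD)
      then show "?K l \<subset> ?K (Suc l)" by (auto simp: atLeast0_lessThan_Suc)
      show "?K (Suc l) \<subseteq> J" using l by (intro K) simp
    qed
    ultimately show "enat (card J) \<le> Sup {enat n |n. \<exists>Z. (\<forall>k\<le>n. closedin ?T (Z k) \<and>
        Z k \<subseteq> image_closure \<and> irreducible_space (subtopology ?T (Z k))) \<and>
        (\<forall>k<n. Z k \<subset> Z (Suc k))}"
      by (intro Sup_upper CollectI exI[of _ "card J"] exI[of _ ?Z] conjI refl) auto
  qed
qed

end

section \<open>Graphs that are not clique stars\<close>

definition nonadjacent :: "'v set \<Rightarrow> 'v set set \<Rightarrow> 'v \<Rightarrow> 'v \<Rightarrow> bool" where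
  "nonadjacent V E u v \<longleftrightarrow> u \<in> V \<and> v \<in> V \<and> u \<noteq> v \<and> {u, v} \<notin> E"

lemma nonadjacent_sym: "nonadjacent V E u v \<Longrightarrow> nonadjacent V E v u"
  by (auto simp: nonadjacent_def insert_commute)

lemma clique_iff_nonadjacent:
  "C \<subseteq> V \<Longrightarrow> clique C E \<longleftrightarrow> (\<forall>u \<in> C. \<forall>v \<in> C. \<not> nonadjacent V E u v)"
  by (auto simp: clique_def nonadjacent_def)

lemma ex_max_clique:
  assumes "finite V" "D \<subseteq> V" "clique D E"
  shows "\<exists>C \<in> max_cliques V E. D \<subseteq> C"
proof -
  let ?A = "{C. C \<subseteq> V \<and> clique C E}"
  have "finite ?A" using assms(1) by simp
  moreover have "D \<in> ?A" using assms by simp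
  ultimately obtain C where "C \<in> ?A" "D \<subseteq> C" "\<forall>B \<in> ?A. C \<subseteq> B \<longrightarrow> C = B"
    using finite_has_maximal2[of ?A D] by blast
  then have "C \<in> max_cliques V E" by (auto simp: max_cliques_def)
  then show ?thesis using \<open>D \<subseteq> C\<close> by blast
qed

lemma cycle_edges_4: "cycle_edges [s, x, t, y] = {{s, x}, {x, t}, {t, y}, {y, s}}"
proof -
  have r: "{i. i < length [s, x, t, y]} = {0, Suc 0, Suc (Suc 0), Suc (Suc (Suc 0))}"
    by (auto simp: less_Suc_eq)
  have l: "length [s, x, t, y] = Suc (Suc (Suc (Suc 0)))" by simp
  show ?thesis
    unfolding cycle_edges_def setcompr_eq_image r
    unfolding image_insert image_empty l by simp
qed

text \<open>Let \<open>s\<close> and \<open>t\<close> be nonadjacent. If neither configuration occurs, the nonneighbours \<open>A\<close> of \<open>t\<close> and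
  \<open>B\<close> of \<open>s\<close> are disjoint cliques without any edge between them, and every other vertex is adjacent
  to all of \<open>A\<close> and \<open>B\<close>. Two nonadjacent vertices among the others would form a chordless square with
  \<open>s\<close> and \<open>t\<close>. So the others form a clique \<open>S\<close>, and the maximal cliques are \<open>S \<union> A\<close> and \<open>S \<union> B\<close>.\<close>

lemma not_clique_star_cases:
  assumes simple: "simple_graph V E" and dec: "decomposable V E" and star: "\<not> clique_star V E"
  obtains (triple) u v w where "nonadjacent V E u v" "nonadjacent V E u w" "nonadjacent V E v w"
  | (path) s p q t where "{p, q} \<in> E" "p \<noteq> q" "nonadjacent V E s t" "nonadjacent V E s q"
      "nonadjacent V E t p"
proof -
  let ?H = "nonadjacent V E"
  have False
    if notriple: "\<And>u v w. ?H u v \<Longrightarrow> ?H u w \<Longrightarrow> ?H v w \<Longrightarrow> False"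
      and nopath: "\<And>s p q t. {p, q} \<in> E \<Longrightarrow> p \<noteq> q \<Longrightarrow> ?H s t \<Longrightarrow> ?H s q \<Longrightarrow> ?H t p \<Longrightarrow> False"
  proof (cases "\<exists>s t. ?H s t")
    case False
    then have "clique V E" by (subst clique_iff_nonadjacent[of V V]) auto
    then have "C = V" if "C \<in> max_cliques V E" for C
      using that unfolding max_cliques_def by blast
    then have "clique_star V E"
      unfolding clique_star_def by (intro exI[of _ "{}"]) (auto simp: clique_def)
    then show False using star by simp
  next
    case True
    then obtain s t where st: "?H s t" by blast
    have ts: "?H t s" using nonadjacent_sym[OF st] .
    have path: "?H p q" if "?H s t" "?H s q" "?H t p" "p \<noteq> q" for s t p q
      using nopath[of p q s t] that by (auto simp: nonadjacent_def)
    have square: "?H s x \<or> ?H s y \<or> ?H t x \<or> ?H t y"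
      if xy: "?H x y" and ne: "x \<noteq> s" "x \<noteq> t" "y \<noteq> s" "y \<noteq> t" for x y
    proof (rule ccontr)
      assume no: "\<not> ?thesis"
      let ?xs = "[s, x, t, y]"
      have e: "{s, x} \<in> E" "{x, t} \<in> E" "{t, y} \<in> E" "{y, s} \<in> E"
      proof -
        have V: "s \<in> V" "t \<in> V" "x \<in> V" "y \<in> V" using st xy by (simp_all add: nonadjacent_def)
        show "{s, x} \<in> E" using no V ne by (simp add: nonadjacent_def)
        show "{x, t} \<in> E" using no V ne by (simp add: nonadjacent_def insert_commute)
        show "{t, y} \<in> E" using no V ne by (simp add: nonadjacent_def)
        show "{y, s} \<in> E" using no V ne by (simp add: nonadjacent_def insert_commute)
      qed
      note edges = cycle_edges_4[of s x t y]
      have "is_cycle V E ?xs"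
        using e st xy ne unfolding is_cycle_def edges by (auto simp: nonadjacent_def)
      then have "has_chord E ?xs" using dec unfolding decomposable_def by auto
      then obtain c where c: "c \<in> E" "c \<subseteq> {s, x, t, y}" "c \<notin> {{s, x}, {x, t}, {t, y}, {y, s}}"
        unfolding has_chord_def edges by auto
      have "card c = 2" using c(1) simple unfolding simple_graph_def nsets_def by auto
      then obtain a b where ab: "c = {a, b}" "a \<noteq> b" unfolding card_2_iff by blast
      have "{s, t} \<notin> E" "{x, y} \<notin> E" using st xy by (auto simp: nonadjacent_def)
      then show False using c unfolding ab using ab(2) by (auto simp: insert_commute)
    qed
    define A where "A = {x. ?H x t}"
    define B where "B = {x. ?H x s}"
    define S where "S = V - A - B"
    have AV: "A \<subseteq> V" "B \<subseteq> V" by (auto simp: A_def B_def nonadjacent_def)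
    have sA: "s \<in> A" "t \<in> B" using st ts by (auto simp: A_def B_def)
    have disj: "A \<inter> B = {}"
      using notriple[of _ t s] ts by (auto simp: A_def B_def)
    have AB: "?H a b" if "a \<in> A" "b \<in> B" for a b
    proof (rule path[OF st])
      show "?H s b" "?H t a" using that by (auto simp: A_def B_def intro: nonadjacent_sym)
      show "a \<noteq> b" using that disj by blast
    qed
    have S: "\<not> ?H x y" if "x \<in> S" "y \<in> S" for x y
    proof
      assume "?H x y"
      moreover have "x \<noteq> s" "x \<noteq> t" "y \<noteq> s" "y \<noteq> t" using that sA by (auto simp: S_def)
      ultimately show False using square[of x y] that
        by (auto simp: S_def A_def B_def dest: nonadjacent_sym)
    qed
    have SA: "\<not> ?H x y" if "x \<in> S" "y \<in> A" for x y
    proof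
      assume "?H x y"
      then have "?H s x"
        using that sA ts by (intro path[of y t x s] nonadjacent_sym[of V E x y])
          (auto simp: A_def S_def)
      then show False using that by (auto simp: S_def B_def dest: nonadjacent_sym)
    qed
    have SB: "\<not> ?H x y" if "x \<in> S" "y \<in> B" for x y
    proof
      assume "?H x y"
      then have "?H t x"
        using that sA st by (intro path[of y s x t] nonadjacent_sym[of V E x y])
          (auto simp: B_def S_def)
      then show False using that by (auto simp: S_def A_def dest: nonadjacent_sym)
    qed
    have AA: "\<not> ?H x y" if "x \<in> A" "y \<in> A" for x y
      using notriple[of x y t] that by (auto simp: A_def)
    have BB: "\<not> ?H x y" if "x \<in> B" "y \<in> B" for x y
      using notriple[of x y s] that by (auto simp: B_def)
    have sub: "S \<union> A \<subseteq> V" "S \<union> B \<subseteq> V" "S \<subseteq> V" using AV by (auto simp: S_def)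
    have SA': "\<not> ?H y x" if "x \<in> S" "y \<in> A" for x y using SA[OF that] nonadjacent_sym by metis
    have SB': "\<not> ?H y x" if "x \<in> S" "y \<in> B" for x y using SB[OF that] nonadjacent_sym by metis
    have "clique (S \<union> A) E"
      unfolding clique_iff_nonadjacent[OF sub(1)] using S SA SA' AA by blast
    moreover have "clique (S \<union> B) E"
      unfolding clique_iff_nonadjacent[OF sub(2)] using S SB SB' BB by blast
    moreover have "clique S E"
      unfolding clique_iff_nonadjacent[OF sub(3)] using S by blast
    moreover have two: "C = S \<union> A \<or> C = S \<union> B" if C: "C \<in> max_cliques V E" for C
    proof -
      have CV: "C \<subseteq> V" and "clique C E" using C by (auto simp: max_cliques_def)
      then have "\<not> ?H a b" if "a \<in> C" "b \<in> C" for a b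
        using that \<open>clique C E\<close> unfolding clique_iff_nonadjacent[OF CV] by blast
      then have "C \<inter> A = {} \<or> C \<inter> B = {}" using AB by blast
      then have "C \<subseteq> S \<union> A \<or> C \<subseteq> S \<union> B" using CV by (auto simp: S_def)
      moreover have max: "D = C" if "D \<subseteq> V" "clique D E" "C \<subseteq> D" for D
        using C that by (simp add: max_cliques_def)
      ultimately show ?thesis
        using max[OF sub(1) \<open>clique (S \<union> A) E\<close>] max[OF sub(2) \<open>clique (S \<union> B) E\<close>] by blast
    qed
    moreover have "C \<inter> D = S" if "C \<in> max_cliques V E" "D \<in> max_cliques V E" "C \<noteq> D" for C D
      using two[OF that(1)] two[OF that(2)] that(3) disj by (auto simp: S_def)
    ultimately have "clique_star V E"
      unfolding clique_star_def by (intro exI[of _ S]) (auto simp: S_def)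
    then show False using star by simp
  qed
  then show ?thesis using triple path by blast
qed

section \<open>Transversality\<close>

lemma states_update:
  assumes "i \<in> states d V" "v \<in> V" "a \<in> {1..d v}"
  shows "i(v := a) \<in> states d V"
  using assms by (auto simp: states_def PiE_iff extensional_def)

definition other_state :: "nat \<Rightarrow> nat" where
  "other_state k = (if k = 1 then 2 else 1)"

lemma other_state: "2 \<le> d v \<Longrightarrow> other_state k \<in> {1..d v}" "other_state k \<noteq> k"
  by (auto simp: other_state_def)

text \<open>A function that is a sum of functions of the clique marginals has this property, because no
  clique contains both \<open>u\<close> and \<open>v\<close>.\<close>

definition additive :: "'v set \<Rightarrow> 'v set set \<Rightarrow> ('v \<Rightarrow> nat) \<Rightarrow> (('v \<Rightarrow> nat) \<Rightarrow> 'c::ab_group_add) \<Rightarrow> bool"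
  where "additive V E d h \<longleftrightarrow> (\<forall>u v i a b. nonadjacent V E u v \<longrightarrow> i \<in> states d V \<longrightarrow>
    a \<in> {1..d u} \<longrightarrow> b \<in> {1..d v} \<longrightarrow>
    h (i(u := a, v := b)) + h i = h (i(u := a)) + h (i(v := b)))"

lemma additiveD:
  "additive V E d h \<Longrightarrow> nonadjacent V E u v \<Longrightarrow> i \<in> states d V \<Longrightarrow> a \<in> {1..d u} \<Longrightarrow> b \<in> {1..d v} \<Longrightarrow>
    h (i(u := a, v := b)) + h i = h (i(u := a)) + h (i(v := b))"
  by (simp add: additive_def)

text \<open>The ratio \<open>r\<close> of two points of the model: its logarithm is additive, it changes with each
  single coordinate, and it has a nontrivial interaction along each edge. The aim is that \<open>r * h\<close>
  is additive for no additive \<open>h\<close> except zero. By the product rule this says that the tangent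
  spaces of the cone over the model at the two points meet only in zero.\<close>

locale transversal_weight =
  fixes V :: "'v set" and E :: "'v set set" and d :: "'v \<Rightarrow> nat" and r :: "('v \<Rightarrow> nat) \<Rightarrow> complex"
  assumes two_states: "\<And>v. v \<in> V \<Longrightarrow> 2 \<le> d v"
    and r_nonzero: "\<And>i. r i \<noteq> 0"
    and r_mult: "\<And>u v i a b. nonadjacent V E u v \<Longrightarrow>
      r (i(u := a, v := b)) * r i = r (i(u := a)) * r (i(v := b))"
    and r_change: "\<And>i u a. u \<in> V \<Longrightarrow> a \<noteq> i u \<Longrightarrow> r (i(u := a)) \<noteq> r i"
    and r_interact: "\<And>i p q a b. {p, q} \<in> E \<Longrightarrow> p \<in> V \<Longrightarrow> q \<in> V \<Longrightarrow> p \<noteq> q \<Longrightarrow> a \<noteq> i p \<Longrightarrow> b \<noteq> i q \<Longrightarrow>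
      r (i(p := a, q := b)) * r i \<noteq> r (i(p := a)) * r (i(q := b))"
begin

text \<open>The difference quotient of \<open>r * h\<close> with respect to \<open>r\<close> when vertex \<open>u\<close> moves to state \<open>a\<close>, less
  the value \<open>h i\<close>. Additivity of \<open>h\<close> and \<open>r * h\<close> across a nonadjacent pair then becomes a relation
  without coefficients, and the slope at \<open>u\<close> depends only on the states of \<open>u\<close> and its
  neighbours.\<close>

definition slope :: "(('v \<Rightarrow> nat) \<Rightarrow> complex) \<Rightarrow> 'v \<Rightarrow> ('v \<Rightarrow> nat) \<Rightarrow> nat \<Rightarrow> complex" where
  "slope h u i a = r (i(u := a)) * (h (i(u := a)) - h i) / (r (i(u := a)) - r i)"

lemma slope_sum:
  assumes h: "additive V E d h" and g: "additive V E d g"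
    and gh: "\<And>i. i \<in> states d V \<Longrightarrow> g i + r i * h i = 0"
    and uv: "nonadjacent V E u v" and i: "i \<in> states d V"
    and a: "a \<in> {1..d u}" "a \<noteq> i u" and b: "b \<in> {1..d v}" "b \<noteq> i v"
  shows "h i + slope h u i a + slope h v i b = 0"
proof -
  have V: "u \<in> V" "v \<in> V" "u \<noteq> v" using uv by (auto simp: nonadjacent_def)
  define r0 ra rb rab where r: "r0 = r i" "ra = r (i(u := a))" "rb = r (i(v := b))"
    "rab = r (i(u := a, v := b))"
  define h0 ha hb hab where hs: "h0 = h i" "ha = h (i(u := a))" "hb = h (i(v := b))"
    "hab = h (i(u := a, v := b))"
  have ia: "i(u := a) \<in> states d V" and ib: "i(v := b) \<in> states d V"
    by (rule states_update[OF i V(1) a(1)], rule states_update[OF i V(2) b(1)])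
  have iab: "i(u := a, v := b) \<in> states d V" by (rule states_update[OF ia V(2) b(1)])
  have m: "rab * r0 = ra * rb" unfolding r by (rule r_mult[OF uv])
  have s: "hab + h0 = ha + hb" unfolding hs by (rule additiveD[OF h uv i a(1) b(1)])
  have "rab * hab + r0 * h0 = ra * ha + rb * hb"
    using additiveD[OF g uv i a(1) b(1)] gh[OF i] gh[OF ia] gh[OF ib] gh[OF iab]
    unfolding r hs by algebra
  then have key: "h0 * (ra - r0) * (rb - r0) + ra * (ha - h0) * (rb - r0) + rb * (hb - h0) * (ra - r0) = 0"
    using m s r_nonzero[of i] unfolding r(1)[symmetric] by algebra
  have n: "ra - r0 \<noteq> 0" "rb - r0 \<noteq> 0" using r_change V a b unfolding r by auto
  have "(h0 + ra * (ha - h0) / (ra - r0) + rb * (hb - h0) / (rb - r0)) * ((ra - r0) * (rb - r0)) =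
    h0 * (ra - r0) * (rb - r0) + ra * (ha - h0) * (rb - r0) + rb * (hb - h0) * (ra - r0)"
    using n by (simp add: distrib_right)
  then show ?thesis using key n unfolding slope_def r hs by auto
qed

lemma slope_invariant:
  assumes h: "additive V E d h" and uw: "nonadjacent V E u w" and i: "i \<in> states d V"
    and a: "a \<in> {1..d u}" "a \<noteq> i u" and c: "c \<in> {1..d w}"
  shows "slope h u (i(w := c)) a = slope h u i a"
proof -
  have V: "u \<in> V" "w \<in> V" "u \<noteq> w" using uw by (auto simp: nonadjacent_def)
  have tw: "i(w := c, u := a) = i(u := a, w := c)" using V by (simp add: fun_upd_twist)
  define r0 ra rc rac where r: "r0 = r i" "ra = r (i(u := a))" "rc = r (i(w := c))"
    "rac = r (i(u := a, w := c))"
  have m: "rac * r0 = ra * rc" unfolding r by (rule r_mult[OF uw])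
  have s: "h (i(u := a, w := c)) - h (i(w := c)) = h (i(u := a)) - h i"
    using additiveD[OF h uw i a(1) c] by (simp add: algebra_simps)
  have n: "ra - r0 \<noteq> 0" using r_change V a unfolding r by auto
  have n': "r0 \<noteq> 0" "rc \<noteq> 0" using r_nonzero unfolding r by auto
  have e: "rac = ra * rc / r0" using m n' by (simp add: field_simps)
  have "rac / (rac - rc) = ra / (ra - r0)"
  proof -
    have "rac - rc = (ra - r0) * (rc / r0)" unfolding e using n' by (simp add: field_simps)
    then show ?thesis unfolding e using n n' by simp
  qed
  then show ?thesis unfolding slope_def tw s
    unfolding r by (metis times_divide_eq_left mult.commute)
qed

text \<open>For three pairwise nonadjacent vertices the three relations force all slopes to be \<open>- h i / 2\<close>.
  Since the slope at \<open>u\<close> is unchanged when \<open>v\<close> moves, so is \<open>h\<close>, and hence the slope at \<open>v\<close> is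
  zero.\<close>

lemma transversal_triple:
  assumes h: "additive V E d h" and g: "additive V E d g"
    and gh: "\<And>i. i \<in> states d V \<Longrightarrow> g i + r i * h i = 0"
    and uvw: "nonadjacent V E u v" "nonadjacent V E u w" "nonadjacent V E v w"
    and i: "i \<in> states d V"
  shows "h i = 0"
proof -
  have V: "u \<in> V" "v \<in> V" "w \<in> V" "u \<noteq> v" using uvw by (auto simp: nonadjacent_def)
  define a b c where abc: "a = other_state (i u)" "b = other_state (i v)" "c = other_state (i w)"
  have a: "a \<in> {1..d u}" "a \<noteq> i u" and b: "b \<in> {1..d v}" "b \<noteq> i v" and c: "c \<in> {1..d w}" "c \<noteq> i w"
    unfolding abc by (rule other_state two_states V)+
  note sum = slope_sum[OF h g gh]
  have half: "2 * slope h u j a = - h j \<and> 2 * slope h v j b' = - h j"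
    if "j \<in> states d V" "j u = i u" "j w = i w" "b' \<in> {1..d v}" "b' \<noteq> j v" for j b'
  proof -
    have "h j + slope h u j a + slope h v j b' = 0" "h j + slope h u j a + slope h w j c = 0"
      "h j + slope h v j b' + slope h w j c = 0"
      using that a c by (auto intro!: sum uvw)
    then show ?thesis by algebra
  qed
  let ?j = "i(v := b)"
  have j: "?j \<in> states d V" by (rule states_update[OF i V(2) b(1)])
  have "2 * slope h u ?j a = - h ?j"
    using half[OF j, of "i v"] uvw V b i by (auto simp: nonadjacent_def states_def PiE_iff)
  moreover have "slope h u ?j a = slope h u i a" by (rule slope_invariant[OF h uvw(1) i a b(1)])
  moreover have i': "2 * slope h u i a = - h i" "2 * slope h v i b = - h i" using half[OF i _ _ b] by auto
  ultimately have "h ?j = h i" by simp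
  then have "slope h v i b = 0" by (simp add: slope_def)
  then show ?thesis using i' by simp
qed

text \<open>Comparing the relations for \<open>s, t\<close> and \<open>s, q\<close>, the slopes at \<open>t\<close> and \<open>q\<close> agree. When \<open>q\<close> moves, the
  change of \<open>h\<close> is the opposite of the change of the slope at \<open>t\<close>, so the definition of the slope at
  \<open>q\<close> is an equation for the slope at \<open>t\<close> and its change. Moving \<open>p\<close> affects neither of these,
  as \<open>p\<close> and \<open>t\<close> are nonadjacent, but it does affect the ratio of the values of \<open>r\<close>; both must
  vanish.\<close>

lemma transversal_path_end:
  assumes h: "additive V E d h" and g: "additive V E d g"
    and gh: "\<And>i. i \<in> states d V \<Longrightarrow> g i + r i * h i = 0"
    and pq: "{p, q} \<in> E" and pq': "p \<noteq> q" and st: "nonadjacent V E s t" and sq: "nonadjacent V E s q"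
    and tp: "nonadjacent V E t p"
    and i: "i \<in> states d V" and b: "b \<in> {1..d t}" "b \<noteq> i t"
  shows "slope h t i b = 0"
proof -
  have V: "s \<in> V" "p \<in> V" "q \<in> V" "t \<in> V" and "s \<noteq> t" "s \<noteq> q" "t \<noteq> p"
    using st sq tp by (auto simp: nonadjacent_def)
  moreover have "s \<noteq> p" "t \<noteq> q" using pq sq tp by (auto simp: nonadjacent_def insert_commute)
  ultimately have ne: "s \<noteq> t" "s \<noteq> q" "t \<noteq> p" "s \<noteq> p" "t \<noteq> q" "p \<noteq> q" using pq' by auto
  define a c p' where ac: "a = other_state (i s)" "c = other_state (i q)" "p' = other_state (i p)"
  have a: "a \<in> {1..d s}" "a \<noteq> i s" and c: "c \<in> {1..d q}" "c \<noteq> i q"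
    and p': "p' \<in> {1..d p}" "p' \<noteq> i p"
    unfolding ac by (rule other_state two_states V)+
  note sum = slope_sum[OF h g gh]
  define \<Delta> where "\<Delta> = slope h t (i(q := c)) b - slope h t i b"
  have step: "r (x(q := c)) * (slope h t i b + \<Delta>) = r x * slope h t i b"
    if x: "x \<in> states d V" "x s = i s" "x q = i q" "x t = i t"
      and inv: "slope h t x b = slope h t i b" "slope h t (x(q := c)) b = slope h t (i(q := c)) b" for x
  proof -
    have xc: "x(q := c) \<in> states d V" by (rule states_update[OF x(1) V(3) c(1)])
    have 1: "h x + slope h s x a + slope h t x b = 0" "h x + slope h s x a + slope h q x c = 0"
      using x a b c by (auto intro!: sum st sq)
    have 2: "h (x(q := c)) + slope h s (x(q := c)) a + slope h t (x(q := c)) b = 0"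
      using x a b ne by (auto intro!: sum[OF _ st xc])
    have 3: "slope h s (x(q := c)) a = slope h s x a"
      using x a by (auto intro!: slope_invariant[OF h sq x(1) _ _ c(1)])
    have "slope h q x c = slope h t i b" using 1 inv by (simp add: add_eq_0_iff)
    moreover have "h (x(q := c)) - h x = - \<Delta>"
      using 1(1) 2 unfolding 3 inv \<Delta>_def by algebra
    moreover have "r (x(q := c)) - r x \<noteq> 0" using r_change[of q c x] V c x by simp
    ultimately have "slope h t i b * (r (x(q := c)) - r x) = - (r (x(q := c)) * \<Delta>)"
      unfolding slope_def[of h q] by (simp add: field_simps)
    then show ?thesis by algebra
  qed
  let ?j = "i(p := p')"
  have j: "?j \<in> states d V" by (rule states_update[OF i V(2) p'(1)])
  have ic: "i(q := c) \<in> states d V" by (rule states_update[OF i V(3) c(1)])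
  have tw: "?j(q := c) = (i(q := c))(p := p')" using ne by (simp add: fun_upd_twist)
  have 1: "r (i(q := c)) * (slope h t i b + \<Delta>) = r i * slope h t i b"
    by (rule step) (use i in auto)
  have 2: "r (?j(q := c)) * (slope h t i b + \<Delta>) = r ?j * slope h t i b"
  proof (rule step[OF j])
    show "slope h t ?j b = slope h t i b" by (rule slope_invariant[OF h tp i b p'(1)])
    show "slope h t (?j(q := c)) b = slope h t (i(q := c)) b"
      unfolding tw using b ne by (intro slope_invariant[OF h tp ic _ _ p'(1)]) auto
  qed (use ne in auto)
  have 3: "r (?j(q := c)) * r i \<noteq> r ?j * r (i(q := c))"
    by (rule r_interact[OF pq V(2,3) ne(6) p'(2) c(2)])
  have "(r (?j(q := c)) * r i - r ?j * r (i(q := c))) * (slope h t i b + \<Delta>) = 0"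
    using 1 2 by algebra
  then have "slope h t i b + \<Delta> = 0" using 3 by auto
  then show ?thesis using 1 r_nonzero[of i] by simp
qed

lemma transversal_path:
  assumes h: "additive V E d h" and g: "additive V E d g"
    and gh: "\<And>i. i \<in> states d V \<Longrightarrow> g i + r i * h i = 0"
    and pq: "{p, q} \<in> E" and pq': "p \<noteq> q" and st: "nonadjacent V E s t" and sq: "nonadjacent V E s q"
    and tp: "nonadjacent V E t p"
    and i: "i \<in> states d V"
  shows "h i = 0"
proof -
  have V: "s \<in> V" "t \<in> V" using st by (auto simp: nonadjacent_def)
  let ?a = "other_state (i s)" and ?b = "other_state (i t)"
  have a: "?a \<in> {1..d s}" "?a \<noteq> i s" and b: "?b \<in> {1..d t}" "?b \<noteq> i t"
    by (rule other_state two_states V)+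
  have "slope h t i ?b = 0" by (rule transversal_path_end[OF h g gh pq pq' st sq tp i b])
  moreover have "slope h s i ?a = 0"
    using pq by (intro transversal_path_end[OF h g gh _ pq'[symmetric] nonadjacent_sym[OF st] tp sq i a])
      (simp_all add: insert_commute)
  ultimately show ?thesis using slope_sum[OF h g gh st i a b] by simp
qed

end

section \<open>Interaction coordinates\<close>

text \<open>State 1 serves as reference state at every vertex, and \<open>t\<close> is subordinate to \<open>i\<close> if it arises from \<open>i\<close>
  by resetting some vertices to state 1.\<close>

definition subordinate :: "'v set \<Rightarrow> ('v \<Rightarrow> nat) \<Rightarrow> ('v \<Rightarrow> nat) \<Rightarrow> bool" where
  "subordinate V t i \<longleftrightarrow> (\<forall>v \<in> V. t v \<noteq> 1 \<longrightarrow> t v = i v)"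

definition support :: "'v set \<Rightarrow> ('v \<Rightarrow> nat) \<Rightarrow> 'v set" where
  "support V t = {v \<in> V. t v \<noteq> 1}"

text \<open>These states index the interactions: the indicators of subordination of such \<open>t\<close> form a basis
  of the sums of functions of the clique marginals.\<close>

definition clique_states :: "'v set \<Rightarrow> 'v set set \<Rightarrow> ('v \<Rightarrow> nat) \<Rightarrow> ('v \<Rightarrow> nat) set" where
  "clique_states V E d = {t \<in> states d V. clique (support V t) E}"

definition base_state :: "'v set \<Rightarrow> 'v \<Rightarrow> nat" where
  "base_state V = (\<lambda>v \<in> V. 1)"

definition monomial :: "'v set \<Rightarrow> ('v \<Rightarrow> nat) set \<Rightarrow> ('v \<Rightarrow> nat) \<Rightarrow> (('v \<Rightarrow> nat) \<Rightarrow> 'c) \<Rightarrow> 'c::comm_monoid_mult"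
  where "monomial V A i u = (\<Prod>t \<in> {t \<in> A. subordinate V t i}. u t)"

lemma finite_max_cliques: "finite V \<Longrightarrow> finite (max_cliques V E)"
  by (rule finite_subset[of _ "Pow V"]) (auto simp: max_cliques_def)

lemma finite_states: "finite V \<Longrightarrow> finite (states d V)"
  by (simp add: states_def finite_PiE)

lemma finite_clique_states: "finite V \<Longrightarrow> finite (clique_states V E d)"
  by (simp add: clique_states_def finite_states)

lemma subordinate_refl: "subordinate V t t"
  by (simp add: subordinate_def)

lemma subordinate_base: "subordinate V (base_state V) i"
  by (simp add: subordinate_def base_state_def)

lemma base_state_in: "(\<And>v. v \<in> V \<Longrightarrow> 2 \<le> d v) \<Longrightarrow> base_state V \<in> clique_states V E d"
  by (fastforce simp: clique_states_def states_def base_state_def support_def clique_def)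

lemma support_subordinate: "subordinate V t i \<Longrightarrow> support V t \<subseteq> support V i"
  by (auto simp: subordinate_def support_def)

lemma support_subordinate_strict:
  assumes "subordinate V t i" "t \<in> states d V" "i \<in> states d V" "t \<noteq> i"
  shows "support V t \<subset> support V i"
proof -
  obtain v where v: "t v \<noteq> i v" using assms(4) by blast
  have "v \<in> V"
  proof (rule ccontr)
    assume "v \<notin> V"
    then have "t v = undefined" "i v = undefined" using assms(2,3) by (auto simp: states_def PiE_iff extensional_def)
    then show False using v by simp
  qed
  then have "v \<in> support V i" "v \<notin> support V t"
    using v assms(1) by (auto simp: subordinate_def support_def)
  then show ?thesis using support_subordinate[OF assms(1)] by blast
qed

lemma card_support_less:
  assumes "finite V" "subordinate V t i" "t \<in> states d V" "i \<in> states d V" "t \<noteq> i"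
  shows "card (support V t) < card (support V i)"
proof (rule psubset_card_mono)
  show "finite (support V i)" using assms(1) by (simp add: support_def)
  show "support V t \<subset> support V i" by (rule support_subordinate_strict[OF assms(2-5)])
qed

text \<open>Moebius inversion on the subsets of the support of \<open>i\<close>: the factor at a state is forced once the
  factors at the states of smaller support are known.\<close>

lemma monomial_inversion:
  fixes F :: "('v \<Rightarrow> nat) \<Rightarrow> real"
  assumes V: "finite V" and F: "\<And>i. 0 < F i"
  shows "\<exists>\<psi>. (\<forall>t. 0 < \<psi> t) \<and> (\<forall>i \<in> states d V. F i = monomial V (states d V) i \<psi>)"
proof -
  let ?R = "states d V"
  let ?B = "\<lambda>i. {t \<in> ?R. subordinate V t i}"
  have fin: "finite (?B i)" for i using finite_states[OF V] by simp
  have "\<exists>\<psi>. (\<forall>t. 0 < \<psi> t) \<and> (\<forall>i \<in> ?R. card (support V i) < n \<longrightarrow> F i = prod \<psi> (?B i))" for n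
  proof (induction n)
    case 0
    show ?case by (rule exI[of _ "\<lambda>_. 1"]) simp
  next
    case (Suc n)
    then obtain \<psi> where pos: "\<forall>t. 0 < \<psi> t"
      and \<psi>: "\<forall>i \<in> ?R. card (support V i) < n \<longrightarrow> F i = prod \<psi> (?B i)" by blast
    let ?\<psi> = "\<lambda>t. if card (support V t) = n then F t / prod \<psi> (?B t - {t}) else \<psi> t"
    have "0 < ?\<psi> t" for t using pos F by (simp add: prod_pos)
    moreover have "F i = prod ?\<psi> (?B i)" if i: "i \<in> ?R" and c: "card (support V i) < Suc n" for i
    proof -
      have less: "card (support V t) < card (support V i)" if "t \<in> ?B i - {i}" for t
        using that i by (intro card_support_less[OF V, of t i d]) auto
      then have "?\<psi> t = \<psi> t" if "t \<in> ?B i - {i}" for t using that c by fastforce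
      then have r: "prod ?\<psi> (?B i - {i}) = prod \<psi> (?B i - {i})" by (intro prod.cong) auto
      have iB: "i \<in> ?B i" using i by (simp add: subordinate_refl)
      have e: "prod ?\<psi> (?B i) = ?\<psi> i * prod \<psi> (?B i - {i})"
        using prod.remove[OF fin iB, of ?\<psi>] unfolding r .
      show ?thesis
      proof (cases "card (support V i) = n")
        case True
        have "prod \<psi> (?B i - {i}) \<noteq> 0" using pos by (simp add: prod_pos less_imp_neq[symmetric] order_less_imp_not_eq2)
        then show ?thesis unfolding e using True by simp
      next
        case False
        then show ?thesis unfolding e using \<psi> i c prod.remove[OF fin iB, of \<psi>] by simp
      qed
    qed
    ultimately show ?case by (intro exI[of _ ?\<psi>] conjI allI ballI impI)
  qed
  then obtain \<psi> where \<psi>: "\<forall>t. 0 < \<psi> t"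
    "\<forall>i \<in> ?R. card (support V i) < Suc (card V) \<longrightarrow> F i = prod \<psi> (?B i)" by blast
  have "card (support V i) < Suc (card V)" for i
    using V by (simp add: support_def less_Suc_eq_le card_mono)
  then show ?thesis using \<psi> unfolding monomial_def by blast
qed

text \<open>Each clique factor does not change when the vertices outside its clique \<open>C\<close> are reset to state 1,
  so its inversion only involves states supported in \<open>C\<close>.\<close>

lemma monomial_of_clique_factors:
  fixes \<theta> :: "'v set \<times> ('v \<Rightarrow> nat) \<Rightarrow> real"
  assumes V: "finite V" and d: "\<And>v. v \<in> V \<Longrightarrow> 2 \<le> d v" and pos: "\<And>x. 0 < \<theta> x"
  shows "\<exists>\<psi>. (\<forall>t. 0 < \<psi> t) \<and> (\<forall>i \<in> states d V.
    (\<Prod>C \<in> max_cliques V E. \<theta> (C, restrict i C)) = monomial V (clique_states V E d) i \<psi>)"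
proof -
  let ?R = "states d V" and ?M = "max_cliques V E"
  have finM: "finite ?M" by (rule finite_max_cliques[OF V])
  have "\<forall>C. \<exists>\<psi>. (\<forall>t. 0 < \<psi> t) \<and> (\<forall>i \<in> ?R. \<theta> (C, restrict i C) = monomial V ?R i \<psi>)"
    using monomial_inversion[OF V, of "\<lambda>i. \<theta> (C, restrict i C)" for C] pos by auto
  then obtain \<psi> where \<psi>: "\<And>C t. 0 < \<psi> C t"
    "\<And>C i. i \<in> ?R \<Longrightarrow> \<theta> (C, restrict i C) = monomial V ?R i (\<psi> C)"
    by metis
  have local: "\<theta> (C, restrict i C) = (\<Prod>t \<in> {t \<in> {t \<in> ?R. subordinate V t i}. support V t \<subseteq> C}. \<psi> C t)"
    if i: "i \<in> ?R" and C: "C \<in> ?M" for i C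
  proof -
    let ?i = "\<lambda>v \<in> V. if v \<in> C then i v else 1"
    have CV: "C \<subseteq> V" using C by (simp add: max_cliques_def)
    have iR: "?i \<in> ?R" using i d by (fastforce simp: states_def PiE_iff)
    have "restrict ?i C = restrict i C" using CV by (auto simp: fun_eq_iff)
    moreover have "{t \<in> ?R. subordinate V t ?i} = {t \<in> {t \<in> ?R. subordinate V t i}. support V t \<subseteq> C}"
      by (auto simp: subordinate_def support_def split: if_splits)
    ultimately show ?thesis using \<psi>(2)[OF iR, of C] by (simp add: monomial_def)
  qed
  define \<Psi> where "\<Psi> t = (\<Prod>C \<in> {C \<in> ?M. support V t \<subseteq> C}. \<psi> C t)" for t
  have "0 < \<Psi> t" for t unfolding \<Psi>_def using \<psi>(1) by (simp add: prod_pos)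
  moreover have "(\<Prod>C \<in> ?M. \<theta> (C, restrict i C)) = monomial V (clique_states V E d) i \<Psi>"
    if i: "i \<in> ?R" for i
  proof -
    have "(\<Prod>C \<in> ?M. \<theta> (C, restrict i C)) =
      (\<Prod>C \<in> ?M. \<Prod>t \<in> {t \<in> {t \<in> ?R. subordinate V t i}. support V t \<subseteq> C}. \<psi> C t)"
      using local[OF i] by (intro prod.cong) auto
    also have "\<dots> = (\<Prod>t \<in> {t \<in> ?R. subordinate V t i}. \<Psi> t)"
      unfolding \<Psi>_def using finM finite_states[OF V] by (intro prod.swap_restrict) auto
    also have "\<dots> = monomial V (clique_states V E d) i \<Psi>"
      unfolding monomial_def
    proof (rule prod.mono_neutral_right)
      show "\<forall>t \<in> {t \<in> ?R. subordinate V t i} - {t \<in> clique_states V E d. subordinate V t i}. \<Psi> t = 1"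
      proof
        fix t assume t: "t \<in> {t \<in> ?R. subordinate V t i} - {t \<in> clique_states V E d. subordinate V t i}"
        then have "\<not> clique (support V t) E" by (auto simp: clique_states_def)
        then have "{C \<in> ?M. support V t \<subseteq> C} = {}"
          unfolding max_cliques_def clique_def by blast
        then show "\<Psi> t = 1" unfolding \<Psi>_def by (simp only: prod.empty)
      qed
    qed (use finite_states[OF V] in \<open>auto simp: clique_states_def\<close>)
    finally show ?thesis .
  qed
  ultimately show ?thesis by blast
qed

text \<open>Each interaction is assigned to one maximal clique containing its support.\<close>

lemma clique_factors_of_monomial:
  fixes \<psi> :: "('v \<Rightarrow> nat) \<Rightarrow> 'c::comm_monoid_mult"
  assumes V: "finite V"
  shows "\<exists>\<theta>. \<forall>i \<in> states d V.
    (\<Prod>C \<in> max_cliques V E. \<theta> (C, restrict i C)) = monomial V (clique_states V E d) i \<psi>"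
proof -
  let ?M = "max_cliques V E" and ?T = "clique_states V E d"
  have finM: "finite ?M" by (rule finite_max_cliques[OF V])
  have "\<forall>t \<in> ?T. \<exists>C. C \<in> ?M \<and> support V t \<subseteq> C"
  proof
    fix t assume "t \<in> ?T"
    then have "support V t \<subseteq> V" "clique (support V t) E" by (auto simp: clique_states_def support_def)
    from ex_max_clique[OF V this] show "\<exists>C. C \<in> ?M \<and> support V t \<subseteq> C" by blast
  qed
  from bchoice[OF this] obtain m where m: "\<forall>t \<in> ?T. m t \<in> ?M \<and> support V t \<subseteq> m t" ..
  define \<theta> where "\<theta> = (\<lambda>(C, j). \<Prod>t \<in> {t \<in> ?T. m t = C \<and> (\<forall>v \<in> support V t. t v = j v)}. \<psi> t)"
  have "(\<Prod>C \<in> ?M. \<theta> (C, restrict i C)) = monomial V ?T i \<psi>" if i: "i \<in> states d V" for i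
  proof -
    have "{t \<in> ?T. m t = C \<and> (\<forall>v \<in> support V t. t v = restrict i C v)} =
      {t \<in> {t \<in> ?T. subordinate V t i}. m t = C}" for C
      using m by (auto simp: subordinate_def support_def subset_iff)
    then have "(\<Prod>C \<in> ?M. \<theta> (C, restrict i C)) =
      (\<Prod>C \<in> ?M. \<Prod>t \<in> {t \<in> {t \<in> ?T. subordinate V t i}. m t = C}. \<psi> t)"
      by (simp add: \<theta>_def)
    also have "\<dots> = (\<Prod>t \<in> {t \<in> ?T. subordinate V t i}. \<psi> t)"
      using m finM finite_clique_states[OF V] by (intro prod.group) auto
    finally show ?thesis by (simp add: monomial_def)
  qed
  then show ?thesis by blast
qed

text \<open>The system is triangular with respect to the size of the support.\<close>

lemma interaction_expansion_unique:
  fixes c :: "('v \<Rightarrow> nat) \<Rightarrow> complex"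
  assumes V: "finite V"
    and zero: "\<And>i. i \<in> states d V \<Longrightarrow> (\<Sum>t \<in> {t \<in> clique_states V E d. subordinate V t i}. c t) = 0"
    and t: "t \<in> clique_states V E d"
  shows "c t = 0"
  using t
proof (induction "card (support V t)" arbitrary: t rule: less_induct)
  case less
  let ?B = "{s \<in> clique_states V E d. subordinate V s t}"
  have tR: "t \<in> states d V" using less.prems by (simp add: clique_states_def)
  have "c s = 0" if s: "s \<in> ?B - {t}" for s
  proof (rule less.hyps)
    show "card (support V s) < card (support V t)"
      using s tR by (intro card_support_less[OF V, of s t d]) (auto simp: clique_states_def)
  qed (use s in simp)
  then have "sum c (?B - {t}) = 0" by simp
  moreover have "sum c ?B = c t + sum c (?B - {t})"
    using less.prems finite_clique_states[OF V] by (intro sum.remove) (auto simp: subordinate_refl)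
  ultimately show ?case using zero[OF tR] by simp
qed

lemma subordinate_update: "t v = 1 \<Longrightarrow> subordinate V t (i(v := a)) \<longleftrightarrow> subordinate V t i"
  by (auto simp: subordinate_def)

lemma additive_interactions:
  fixes c :: "('v \<Rightarrow> nat) \<Rightarrow> complex"
  assumes V: "finite V"
  shows "additive V E d (\<lambda>i. \<Sum>t \<in> {t \<in> clique_states V E d. subordinate V t i}. c t)"
  unfolding additive_def
proof (intro allI impI)
  fix u v i a b assume uv: "nonadjacent V E u v"
  let ?T = "clique_states V E d"
  let ?x = "\<lambda>i t. if subordinate V t i then c t else 0"
  have e: "(\<Sum>t \<in> {t \<in> ?T. subordinate V t i}. c t) = (\<Sum>t \<in> ?T. ?x i t)" for i
    using finite_clique_states[OF V] by (simp add: sum.inter_filter)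
  have "?x (i(u := a, v := b)) t + ?x i t = ?x (i(u := a)) t + ?x (i(v := b)) t" if t: "t \<in> ?T" for t
  proof -
    have uvne: "u \<noteq> v" using uv by (simp add: nonadjacent_def)
    have "t u = 1 \<or> t v = 1"
      using uv t by (auto simp: nonadjacent_def clique_states_def support_def clique_def)
    then show ?thesis
    proof
      assume "t v = 1"
      then show ?thesis by (simp add: subordinate_update)
    next
      assume "t u = 1"
      then show ?thesis unfolding fun_upd_twist[OF uvne] by (simp add: subordinate_update)
    qed
  qed
  then show "(\<Sum>t \<in> {t \<in> ?T. subordinate V t (i(u := a, v := b))}. c t) + (\<Sum>t \<in> {t \<in> ?T. subordinate V t i}. c t) =
    (\<Sum>t \<in> {t \<in> ?T. subordinate V t (i(u := a))}. c t) + (\<Sum>t \<in> {t \<in> ?T. subordinate V t (i(v := b))}. c t)"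
    unfolding e sum.distrib[symmetric] by (rule sum.cong[OF refl])
qed

lemma monomial_derivative:
  fixes w :: "('v \<Rightarrow> nat) \<Rightarrow> complex"
  assumes A: "finite A" and w: "\<And>t. t \<in> A \<Longrightarrow> w t \<noteq> 0"
  shows "((\<lambda>s. monomial V A i (\<lambda>t. w t + s * v t)) has_field_derivative
    (\<Sum>t \<in> A. v t * (if subordinate V t i then monomial V A i w / w t else 0))) (at 0)"
proof -
  let ?B = "{t \<in> A. subordinate V t i}"
  have "((\<lambda>s. \<Prod>t \<in> ?B. w t + s * v t) has_field_derivative
    (\<Sum>t \<in> ?B. v t * (\<Prod>t' \<in> ?B - {t}. w t' + 0 * v t'))) (at 0)"
    by (intro has_field_derivative_prod) (auto intro!: derivative_eq_intros)
  also have "(\<Sum>t \<in> ?B. v t * (\<Prod>t' \<in> ?B - {t}. w t' + 0 * v t')) =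
      (\<Sum>t \<in> ?B. v t * (monomial V A i w / w t))"
  proof (intro sum.cong refl)
    fix t assume t: "t \<in> ?B"
    have "monomial V A i w = w t * (\<Prod>t' \<in> ?B - {t}. w t')"
      unfolding monomial_def using A t by (intro prod.remove) auto
    then show "v t * (\<Prod>t' \<in> ?B - {t}. w t' + 0 * v t') = v t * (monomial V A i w / w t)"
      using w t by simp
  qed
  also have "\<dots> = (\<Sum>t \<in> A. v t * (if subordinate V t i then monomial V A i w / w t else 0))"
    using A by (simp add: sum.inter_filter if_distrib[of "\<lambda>x. _ * x"] cong: if_cong)
  finally show ?thesis by (simp add: monomial_def)
qed

lemma monomial_poly: "A \<subseteq> J \<Longrightarrow> monomial V A i \<in> poly_funs J"
  unfolding monomial_def[abs_def] by (intro poly_funs_prod poly_funs.coord) auto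

lemma monomial_split_base:
  assumes "finite A" "base_state V \<in> A"
  shows "monomial V A i u = u (base_state V) * monomial V (A - {base_state V}) i u"
proof -
  have "{t \<in> A. subordinate V t i} - {base_state V} = {t \<in> A - {base_state V}. subordinate V t i}" by auto
  then show ?thesis unfolding monomial_def
    using prod.remove[of "{t \<in> A. subordinate V t i}" "base_state V" u] assms
    by (simp add: subordinate_base)
qed

lemma monomial_cong: "(\<And>t. t \<in> A \<Longrightarrow> u t = u' t) \<Longrightarrow> monomial V A i u = monomial V A i u'"
  unfolding monomial_def by (intro prod.cong) auto

lemma monomial_one: "monomial V A i (\<lambda>_. 1) = 1"
  by (simp add: monomial_def)

section \<open>The quadratic weight\<close>

text \<open>Squaring the sum over a clique creates an interaction of the same sign along each of its edges,
  so no cancellation between cliques can occur.\<close>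

definition quadratic_weight :: "'v set \<Rightarrow> 'v set set \<Rightarrow> ('v \<Rightarrow> nat) \<Rightarrow> real" where
  "quadratic_weight V E i = (\<Sum>C \<in> max_cliques V E. (\<Sum>v \<in> C. real (i v))\<^sup>2)"

lemma sum_update:
  assumes "finite C"
  shows "(\<Sum>v \<in> C. real ((i(p := a)) v)) =
    (\<Sum>v \<in> C. real (i v)) + (if p \<in> C then real a - real (i p) else 0)"
proof (cases "p \<in> C")
  case True
  have "(\<Sum>v \<in> C - {p}. real ((i(p := a)) v)) = (\<Sum>v \<in> C - {p}. real (i v))"
    by (intro sum.cong) auto
  then show ?thesis using sum.remove[OF assms True, of "\<lambda>v. real ((i(p := a)) v)"]
      sum.remove[OF assms True, of "\<lambda>v. real (i v)"] True by simp
next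
  case False
  then show ?thesis by (auto intro!: sum.cong)
qed

lemma quadratic_weight_mixed_difference:
  assumes V: "finite V" and pq: "p \<noteq> q"
  shows "quadratic_weight V E (i(p := a, q := b)) + quadratic_weight V E i =
    quadratic_weight V E (i(p := a)) + quadratic_weight V E (i(q := b)) +
    2 * (real a - real (i p)) * (real b - real (i q)) * card {C \<in> max_cliques V E. p \<in> C \<and> q \<in> C}"
proof -
  let ?M = "max_cliques V E"
  let ?S = "\<lambda>i C. \<Sum>v \<in> C. real (i v)"
  have finM: "finite ?M" by (rule finite_max_cliques[OF V])
  let ?x = "real a - real (i p)" and ?y = "real b - real (i q)"
  have "(?S (i(p := a, q := b)) C)\<^sup>2 + (?S i C)\<^sup>2 =
    (?S (i(p := a)) C)\<^sup>2 + (?S (i(q := b)) C)\<^sup>2 + (if p \<in> C \<and> q \<in> C then 2 * ?x * ?y else 0)"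
    if "C \<in> ?M" for C
  proof -
    have "finite C" using that V by (auto simp: max_cliques_def intro: finite_subset)
    then show ?thesis using pq unfolding sum_update[OF \<open>finite C\<close>]
      by (simp add: power2_eq_square algebra_simps)
  qed
  then have "(\<Sum>C \<in> ?M. (?S (i(p := a, q := b)) C)\<^sup>2 + (?S i C)\<^sup>2) =
    (\<Sum>C \<in> ?M. (?S (i(p := a)) C)\<^sup>2 + (?S (i(q := b)) C)\<^sup>2 + (if p \<in> C \<and> q \<in> C then 2 * ?x * ?y else 0))"
    by (intro sum.cong) auto
  moreover have "(\<Sum>C \<in> ?M. if p \<in> C \<and> q \<in> C then 2 * ?x * ?y else 0) =
    2 * ?x * ?y * card {C \<in> ?M. p \<in> C \<and> q \<in> C}"
    using finM by (simp add: sum.inter_filter[symmetric])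
  ultimately show ?thesis unfolding quadratic_weight_def sum.distrib by simp
qed

lemma quadratic_weight_change:
  assumes V: "finite V" and u: "u \<in> V" and a: "a \<noteq> i u"
  shows "quadratic_weight V E (i(u := a)) \<noteq> quadratic_weight V E i"
proof -
  let ?M = "max_cliques V E"
  let ?S = "\<lambda>i C. \<Sum>v \<in> C. real (i v)"
  have finM: "finite ?M" by (rule finite_max_cliques[OF V])
  have finC: "finite C" if "C \<in> ?M" for C using that V by (auto simp: max_cliques_def intro: finite_subset)
  let ?x = "real a - real (i u)"
  let ?N = "{C \<in> ?M. u \<in> C}"
  have "quadratic_weight V E (i(u := a)) - quadratic_weight V E i =
    (\<Sum>C \<in> ?M. if u \<in> C then ?x * (?S (i(u := a)) C + ?S i C) else 0)"
    unfolding quadratic_weight_def sum_subtractf[symmetric]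
  proof (intro sum.cong refl)
    fix C assume "C \<in> ?M"
    show "(?S (i(u := a)) C)\<^sup>2 - (?S i C)\<^sup>2 = (if u \<in> C then ?x * (?S (i(u := a)) C + ?S i C) else 0)"
      unfolding sum_update[OF finC[OF \<open>C \<in> ?M\<close>]] by (simp add: power2_eq_square algebra_simps)
  qed
  also have "\<dots> = ?x * (\<Sum>C \<in> ?N. ?S (i(u := a)) C + ?S i C)"
    unfolding sum_distrib_left unfolding sum.inter_filter[OF finM] by (rule refl)
  finally have e: "quadratic_weight V E (i(u := a)) - quadratic_weight V E i =
    ?x * (\<Sum>C \<in> ?N. ?S (i(u := a)) C + ?S i C)" .
  obtain C where C: "C \<in> ?M" "{u} \<subseteq> C"
    using ex_max_clique[OF V, of "{u}" E] u by (auto simp: clique_def)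
  have "0 < (\<Sum>C \<in> ?N. ?S (i(u := a)) C + ?S i C)"
  proof (rule sum_pos)
    show "finite ?N" using finM by simp
    show "?N \<noteq> {}" using C by auto
    fix C assume C: "C \<in> ?N"
    have "real ((i(u := a)) u) \<le> ?S (i(u := a)) C" "real (i u) \<le> ?S i C"
      using C finC by (intro member_le_sum; simp)+
    moreover have "0 < real a + real (i u)" using a by linarith
    ultimately show "0 < ?S (i(u := a)) C + ?S i C" by simp
  qed
  then have "?x * (\<Sum>C \<in> ?N. ?S (i(u := a)) C + ?S i C) \<noteq> 0" using a by simp
  then show ?thesis using e by auto
qed

lemma transversal_quadratic_weight:
  assumes simple: "simple_graph V E" and d: "\<And>v. v \<in> V \<Longrightarrow> 2 \<le> d v"
  shows "transversal_weight V E d (\<lambda>i. complex_of_real (exp (quadratic_weight V E i)))"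
proof
  have V: "finite V" using simple by (simp add: simple_graph_def)
  let ?r = "\<lambda>i. complex_of_real (exp (quadratic_weight V E i))"
  have r: "?r i * ?r j = complex_of_real (exp (quadratic_weight V E i + quadratic_weight V E j))" for i j
    by (simp add: exp_add)
  show "?r (i(u := a, v := b)) * ?r i = ?r (i(u := a)) * ?r (i(v := b))"
    if uv: "nonadjacent V E u v" for u v i a b
  proof -
    have "{C \<in> max_cliques V E. u \<in> C \<and> v \<in> C} = {}"
      using uv by (auto simp: nonadjacent_def max_cliques_def clique_def)
    then have "card {C \<in> max_cliques V E. u \<in> C \<and> v \<in> C} = 0" by (simp only: card.empty)
    then show ?thesis
      unfolding r using quadratic_weight_mixed_difference[OF V, of u v E i a b] uv
      by (simp add: nonadjacent_def)
  qed
  show "?r (i(u := a)) \<noteq> ?r i" if "u \<in> V" "a \<noteq> i u" for i u a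
    using quadratic_weight_change[of V u a i E] V that by simp
  show "?r (i(p := a, q := b)) * ?r i \<noteq> ?r (i(p := a)) * ?r (i(q := b))"
    if pq: "{p, q} \<in> E" "p \<in> V" "q \<in> V" "p \<noteq> q" "a \<noteq> i p" "b \<noteq> i q" for i p q a b
  proof -
    have "clique {p, q} E" using pq by (auto simp: clique_def insert_commute)
    then obtain C where "C \<in> max_cliques V E" "{p, q} \<subseteq> C"
      using ex_max_clique[OF V, of "{p, q}" E] pq by auto
    then have "{C \<in> max_cliques V E. p \<in> C \<and> q \<in> C} \<noteq> {}" by auto
    moreover have "finite {C \<in> max_cliques V E. p \<in> C \<and> q \<in> C}"
      using finite_max_cliques[OF V] by simp
    ultimately have "card {C \<in> max_cliques V E. p \<in> C \<and> q \<in> C} \<noteq> 0" by simp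
    then have "2 * (real a - real (i p)) * (real b - real (i q)) *
        card {C \<in> max_cliques V E. p \<in> C \<and> q \<in> C} \<noteq> 0" using pq by simp
    then show ?thesis
      unfolding r of_real_eq_iff exp_inj_iff
      using quadratic_weight_mixed_difference[OF V pq(4), of E i a b] by linarith
  qed
qed (use d in auto)

section \<open>The model and its mixtures as normalized images\<close>

definition positive_real :: "complex \<Rightarrow> bool" where
  "positive_real z \<longleftrightarrow> z \<in> \<real> \<and> 0 < Re z"

lemma positive_real_iff: "positive_real z \<longleftrightarrow> (\<exists>x > 0. z = of_real x)"
  by (auto simp: positive_real_def elim!: Reals_cases)

lemma positive_real_nonzero: "positive_real z \<Longrightarrow> z \<noteq> 0"
  by (auto simp: positive_real_def)

lemma positive_real_mult: "positive_real y \<Longrightarrow> positive_real z \<Longrightarrow> positive_real (y * z)"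
  unfolding positive_real_iff by (metis mult_pos_pos of_real_mult)

lemma positive_real_divide: "positive_real y \<Longrightarrow> positive_real z \<Longrightarrow> positive_real (y / z)"
  unfolding positive_real_iff by (metis divide_pos_pos of_real_divide)

lemma positive_real_add: "positive_real y \<Longrightarrow> positive_real z \<Longrightarrow> positive_real (y + z)"
  by (simp add: positive_real_def)

lemma positive_real_prod:
  "(\<And>t. t \<in> A \<Longrightarrow> positive_real (u t)) \<Longrightarrow> positive_real (\<Prod>t \<in> A. u t)"
proof (induction A rule: infinite_finite_induct)
  case (insert t A)
  then show ?case by (simp add: positive_real_mult)
qed (simp_all add: positive_real_def)

lemma positive_real_sum:
  "finite A \<Longrightarrow> A \<noteq> {} \<Longrightarrow> (\<And>t. t \<in> A \<Longrightarrow> positive_real (u t)) \<Longrightarrow> positive_real (\<Sum>t \<in> A. u t)"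
  by (auto simp: positive_real_def intro!: sum_pos)

lemma in_orthant_iff: "u \<in> orthant J \<longleftrightarrow> (\<forall>j \<in> J. positive_real (u j))"
  by (simp add: orthant_def positive_real_def)

lemma open_simplex_iff:
  "p \<in> open_simplex I \<longleftrightarrow> p \<in> affine_space I \<and> (\<forall>i \<in> I. positive_real (p i)) \<and> (\<Sum>i \<in> I. p i) = 1"
  by (simp add: open_simplex_def positive_real_def)

lemma positive_monomial:
  "u \<in> orthant J \<Longrightarrow> A \<subseteq> J \<Longrightarrow> positive_real (monomial V A i u)"
  unfolding monomial_def in_orthant_iff by (intro positive_real_prod) auto

locale graph_states =
  fixes V :: "'v set" and E :: "'v set set" and d :: "'v \<Rightarrow> nat"
  assumes simple: "simple_graph V E" and two_states: "\<And>v. v \<in> V \<Longrightarrow> 2 \<le> d v"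
begin

abbreviation "R \<equiv> states d V"
abbreviation "T \<equiv> clique_states V E d"
abbreviation "b \<equiv> base_state V"
abbreviation "T' \<equiv> T - {b}"

lemma finite_V: "finite V"
  using simple by (simp add: simple_graph_def)

lemma b_in_T: "b \<in> T"
  using base_state_in two_states by blast

lemma b_in_R: "b \<in> R"
  using b_in_T by (simp add: clique_states_def)

lemma finite_T: "finite T"
  by (rule finite_clique_states[OF finite_V])

lemma monomial_T: "monomial V T i u = u b * monomial V T' i u"
  by (rule monomial_split_base[OF finite_T b_in_T])

lemma parametrization_model: "parametrization R T' (monomial V T')"
proof
  show "(\<Sum>i \<in> R. monomial V T' i u) \<noteq> 0" if "u \<in> orthant T'" for u
    using that b_in_R finite_states[OF finite_V]
    by (intro positive_real_nonzero positive_real_sum positive_monomial[OF that]) auto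
qed (use finite_states[OF finite_V] finite_T monomial_poly[OF subset_refl] in auto)

lemma positive_sum_model:
  assumes "u \<in> orthant T'"
  shows "positive_real (\<Sum>i \<in> R. monomial V T' i u)"
  using b_in_R finite_states[OF finite_V]
  by (intro positive_real_sum positive_monomial[OF assms]) auto

text \<open>The parameter at the base state is a common factor of all coordinates, so the condition of
  coordinate sum one determines it.\<close>

lemma graphical_model_eq: "graphical_model V E d = normalized_image R T' (monomial V T')"
proof (intro equalityI subsetI)
  fix p assume p: "p \<in> graphical_model V E d"
  then obtain \<theta> where \<theta>: "p = monomial_map V E d \<theta>" and simplex: "p \<in> open_simplex R"
    by (auto simp: graphical_model_def)
  have p\<theta>: "p i = (\<Prod>C \<in> max_cliques V E. \<theta> (C, restrict i C))" if "i \<in> R" for i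
    using that by (simp add: \<theta> monomial_map_def)
  \<comment> \<open>The coordinates of \<open>p\<close> are positive, so complex parameters may be replaced by their norms.
    Parameters that enter no coordinate may vanish and are set to one.\<close>
  define \<theta>' where "\<theta>' x = (if \<theta> x = 0 then 1 else norm (\<theta> x))" for x
  have "0 < \<theta>' x" for x by (simp add: \<theta>'_def)
  then obtain \<psi> where \<psi>: "\<And>t. 0 < \<psi> t" "\<And>i. i \<in> R \<Longrightarrow>
    (\<Prod>C \<in> max_cliques V E. \<theta>' (C, restrict i C)) = monomial V T i \<psi>"
    using monomial_of_clique_factors[of V d \<theta>' E] finite_V two_states by blast
  let ?u = "\<lambda>t. complex_of_real (\<psi> t)"
  have u: "?u \<in> orthant T'" using \<psi>(1) by (simp add: orthant_def)
  have pu: "p i = ?u b * monomial V T' i ?u" if i: "i \<in> R" for i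
  proof -
    have pos: "positive_real (p i)" using simplex i by (simp add: open_simplex_iff)
    then have "p i = complex_of_real (norm (p i))" by (auto simp: positive_real_iff)
    also have "norm (p i) = (\<Prod>C \<in> max_cliques V E. norm (\<theta> (C, restrict i C)))"
      by (simp add: p\<theta>[OF i] prod_norm)
    also have "\<dots> = (\<Prod>C \<in> max_cliques V E. \<theta>' (C, restrict i C))"
    proof (intro prod.cong refl)
      fix C assume "C \<in> max_cliques V E"
      then have "\<theta> (C, restrict i C) \<noteq> 0"
        using positive_real_nonzero[OF pos] finite_max_cliques[OF finite_V] unfolding p\<theta>[OF i] by auto
      then show "norm (\<theta> (C, restrict i C)) = \<theta>' (C, restrict i C)" by (simp add: \<theta>'_def)
    qed
    also have "complex_of_real \<dots> = monomial V T i ?u" by (simp add: \<psi>(2)[OF i] monomial_def)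
    finally show ?thesis by (simp add: monomial_T)
  qed
  have "1 = (\<Sum>i \<in> R. p i)" using simplex by (simp add: open_simplex_iff)
  also have "\<dots> = ?u b * (\<Sum>i \<in> R. monomial V T' i ?u)" by (simp add: pu sum_distrib_left)
  finally have "?u b = 1 / (\<Sum>i \<in> R. monomial V T' i ?u)"
    using positive_real_nonzero[OF positive_sum_model[OF u]] by (simp add: field_simps)
  moreover have "p \<in> affine_space R" using simplex by (simp add: open_simplex_iff)
  ultimately have "p = (\<lambda>i \<in> R. monomial V T' i ?u / (\<Sum>i \<in> R. monomial V T' i ?u))"
    using pu by (auto simp: affine_space_def PiE_iff extensional_def fun_eq_iff)
  then show "p \<in> normalized_image R T' (monomial V T')"
    unfolding normalized_image_def using u by blast
next
  fix p assume "p \<in> normalized_image R T' (monomial V T')"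
  then obtain u where u: "u \<in> orthant T'"
    and p: "p = (\<lambda>i \<in> R. monomial V T' i u / (\<Sum>i \<in> R. monomial V T' i u))"
    by (auto simp: normalized_image_def)
  let ?\<sigma> = "\<Sum>i \<in> R. monomial V T' i u"
  note \<sigma> = positive_sum_model[OF u]
  let ?u = "u(b := 1 / ?\<sigma>)"
  obtain \<theta> where \<theta>: "\<And>i. i \<in> R \<Longrightarrow> (\<Prod>C \<in> max_cliques V E. \<theta> (C, restrict i C)) = monomial V T i ?u"
    using clique_factors_of_monomial[OF finite_V, of d E ?u] by blast
  have pi: "p i = (\<Prod>C \<in> max_cliques V E. \<theta> (C, restrict i C))" if i: "i \<in> R" for i
  proof -
    have "monomial V T' i ?u = monomial V T' i u" by (rule monomial_cong) auto
    then show ?thesis unfolding \<theta>[OF i] monomial_T using i by (simp add: p)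
  qed
  let ?\<theta> = "restrict \<theta> (param_index V E d)"
  have "(C, restrict i C) \<in> param_index V E d" if "i \<in> R" "C \<in> max_cliques V E" for i C
    using that by (auto simp: param_index_def states_def max_cliques_def PiE_iff)
  then have "p = monomial_map V E d ?\<theta>"
    unfolding monomial_map_def using pi p by (auto simp: fun_eq_iff intro!: prod.cong)
  moreover have "?\<theta> \<in> affine_space (param_index V E d)" by (simp add: affine_space_def)
  moreover have "p \<in> open_simplex R"
    unfolding open_simplex_iff
  proof (intro conjI ballI)
    show "p \<in> affine_space R" by (simp add: p affine_space_def)
    show "positive_real (p i)" if "i \<in> R" for i
      using that \<sigma> positive_monomial[OF u] by (simp add: p positive_real_divide)
    show "(\<Sum>i \<in> R. p i) = 1"
      using positive_real_nonzero[OF \<sigma>] by (simp add: p flip: sum_divide_distrib)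
  qed
  ultimately show "p \<in> graphical_model V E d" by (auto simp: graphical_model_def)
qed

text \<open>The second component also keeps the parameter of the base state. It scales that component, and
  stands for the ratio of the two mixture weights.\<close>

definition mixture_index :: "(nat \<times> ('v \<Rightarrow> nat)) set" where
  "mixture_index = {1} \<times> T' \<union> {2} \<times> T"

definition mixture_coord :: "('v \<Rightarrow> nat) \<Rightarrow> (nat \<times> ('v \<Rightarrow> nat) \<Rightarrow> complex) \<Rightarrow> complex" where
  "mixture_coord i u = monomial V T' i (\<lambda>t. u (1, t)) + monomial V T i (\<lambda>t. u (2, t))"

lemma orthant_mixture:
  "u \<in> orthant mixture_index \<longleftrightarrow> (\<lambda>t. u (1, t)) \<in> orthant T' \<and> (\<lambda>t. u (2, t)) \<in> orthant T"
  by (auto simp: in_orthant_iff mixture_index_def)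

lemma positive_mixture_coord:
  "u \<in> orthant mixture_index \<Longrightarrow> positive_real (mixture_coord i u)"
  unfolding mixture_coord_def orthant_mixture
  by (intro positive_real_add positive_monomial) auto

lemma parametrization_mixture: "parametrization R mixture_index mixture_coord"
proof
  show "finite mixture_index" using finite_T by (simp add: mixture_index_def)
  show "mixture_coord i \<in> poly_funs mixture_index" for i
    unfolding mixture_coord_def[abs_def] monomial_def
    by (intro poly_funs.add poly_funs_prod poly_funs.coord) (auto simp: mixture_index_def)
  show "(\<Sum>i \<in> R. mixture_coord i u) \<noteq> 0" if "u \<in> orthant mixture_index" for u
    using b_in_R finite_states[OF finite_V]
    by (intro positive_real_nonzero positive_real_sum positive_mixture_coord[OF that]) auto
qed (rule finite_states[OF finite_V])

lemma orthant_mono: "u \<in> orthant J \<Longrightarrow> K \<subseteq> J \<Longrightarrow> u \<in> orthant K"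
  by (auto simp: orthant_def)

lemma mixture_eq:
  "mixture 2 R (graphical_model V E d) = normalized_image R mixture_index mixture_coord"
proof (intro equalityI subsetI)
  fix x assume "x \<in> mixture 2 R (graphical_model V E d)"
  then obtain \<pi> p where \<pi>: "\<pi> \<in> open_simplex {1..2::nat}"
    and p: "\<forall>k \<in> {1..2}. p k \<in> graphical_model V E d"
    and x: "x = (\<lambda>i \<in> R. \<Sum>k = 1..2. \<pi> k * p k i)"
    by (auto simp: mixture_def)
  have "\<forall>k \<in> {1..2}. \<exists>u. u \<in> orthant T' \<and>
      p k = (\<lambda>i \<in> R. monomial V T' i u / (\<Sum>i \<in> R. monomial V T' i u))"
    using p unfolding graphical_model_eq normalized_image_def by blast
  from bchoice[OF this] obtain u where u: "\<forall>k \<in> {1..2}. u k \<in> orthant T' \<and>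
      p k = (\<lambda>i \<in> R. monomial V T' i (u k) / (\<Sum>i \<in> R. monomial V T' i (u k)))" ..
  define s where "s k = (\<Sum>i \<in> R. monomial V T' i (u k))" for k
  have s: "positive_real (s 1)" "positive_real (s 2)"
    unfolding s_def using u by (auto intro: positive_sum_model)
  have \<pi>12: "positive_real (\<pi> 1)" "positive_real (\<pi> 2)" using \<pi> by (auto simp: open_simplex_iff)
  have I2: "{1..2::nat} = {1, 2}" by auto
  have \<pi>1: "\<pi> 1 + \<pi> 2 = 1" using \<pi> unfolding open_simplex_iff I2 by simp
  note n = positive_real_nonzero[OF s(1)] positive_real_nonzero[OF s(2)]
    positive_real_nonzero[OF \<pi>12(1)] positive_real_nonzero[OF \<pi>12(2)]
  \<comment> \<open>With the first component left unnormalized, \<open>\<tau>\<close> is the factor that gives the second one its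
    share.\<close>
  define \<tau> where "\<tau> = \<pi> 2 * s 1 / (\<pi> 1 * s 2)"
  define w where "w = (\<lambda>(k::nat, t). if k = 2 \<and> t = b then \<tau> else u k t)"
  have "positive_real \<tau>" unfolding \<tau>_def by (intro positive_real_divide positive_real_mult s \<pi>12)
  then have w: "w \<in> orthant mixture_index"
    using u unfolding orthant_mixture by (auto simp: w_def in_orthant_iff)
  have wi: "mixture_coord i w = monomial V T' i (u 1) + \<tau> * monomial V T' i (u 2)" for i
  proof -
    have "monomial V T' i (\<lambda>t. w (2, t)) = monomial V T' i (u 2)"
      by (rule monomial_cong) (auto simp: w_def)
    moreover have "monomial V T' i (\<lambda>t. w (1, t)) = monomial V T' i (u 1)"
      by (rule monomial_cong) (auto simp: w_def)
    moreover have "w (2, b) = \<tau>" by (simp add: w_def)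
    ultimately show ?thesis by (simp add: mixture_coord_def monomial_T)
  qed
  have sum: "(\<Sum>i \<in> R. mixture_coord i w) = s 1 + \<tau> * s 2"
    unfolding wi sum.distrib s_def sum_distrib_left by simp
  have "\<pi> 1 * (s 1 + \<tau> * s 2) = s 1 * (\<pi> 1 + \<pi> 2)"
    unfolding \<tau>_def using n by (simp add: field_simps)
  then have "\<pi> 1 * (s 1 + \<tau> * s 2) = s 1" unfolding \<pi>1 by simp
  then have \<sigma>: "s 1 + \<tau> * s 2 = s 1 / \<pi> 1" using n by (simp add: eq_divide_eq mult.commute)
  have "x i = mixture_coord i w / (\<Sum>i \<in> R. mixture_coord i w)" if i: "i \<in> R" for i
  proof -
    have "x i = \<pi> 1 * (monomial V T' i (u 1) / s 1) + \<pi> 2 * (monomial V T' i (u 2) / s 2)"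
    proof -
      have "p 1 i = monomial V T' i (u 1) / s 1" "p 2 i = monomial V T' i (u 2) / s 2"
        using i u by (auto simp: s_def)
      then show ?thesis unfolding x I2 using i by simp
    qed
    also have "\<dots> = (monomial V T' i (u 1) + \<tau> * monomial V T' i (u 2)) / (s 1 / \<pi> 1)"
      unfolding \<tau>_def using n by (simp add: field_simps)
    finally show ?thesis unfolding sum \<sigma> unfolding wi .
  qed
  then have "x = (\<lambda>i \<in> R. mixture_coord i w / (\<Sum>i \<in> R. mixture_coord i w))"
    unfolding x by (auto simp: fun_eq_iff)
  then show "x \<in> normalized_image R mixture_index mixture_coord"
    unfolding normalized_image_def using w by blast
next
  fix x assume "x \<in> normalized_image R mixture_index mixture_coord"
  then obtain w where w: "w \<in> orthant mixture_index"
    and x: "x = (\<lambda>i \<in> R. mixture_coord i w / (\<Sum>i \<in> R. mixture_coord i w))"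
    by (auto simp: normalized_image_def)
  define u where "u k = (\<lambda>t. w (k, t))" for k :: nat
  have u: "u 1 \<in> orthant T'" "u 2 \<in> orthant T"
    using w unfolding orthant_mixture u_def by auto
  have u2: "u 2 \<in> orthant T'" using orthant_mono[OF u(2)] by blast
  define s where "s k = (\<Sum>i \<in> R. monomial V T' i (u k))" for k
  define \<tau> where "\<tau> = u 2 b"
  have \<tau>: "positive_real \<tau>" using u(2) b_in_T by (auto simp: in_orthant_iff \<tau>_def)
  have s: "positive_real (s 1)" "positive_real (s 2)"
    unfolding s_def by (rule positive_sum_model u(1) u2)+
  have wi: "mixture_coord i w = monomial V T' i (u 1) + \<tau> * monomial V T' i (u 2)" for i
    unfolding mixture_coord_def monomial_T u_def \<tau>_def by simp
  have sum: "(\<Sum>i \<in> R. mixture_coord i w) = s 1 + \<tau> * s 2"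
    unfolding wi sum.distrib s_def sum_distrib_left by simp
  have S: "positive_real (s 1 + \<tau> * s 2)" by (intro positive_real_add positive_real_mult s \<tau>)
  note n = positive_real_nonzero[OF s(1)] positive_real_nonzero[OF s(2)] positive_real_nonzero[OF S]
  define \<pi> where "\<pi> = (\<lambda>k \<in> {1..2::nat}. (if k = 1 then s 1 else \<tau> * s 2) / (s 1 + \<tau> * s 2))"
  define p where "p k = (\<lambda>i \<in> R. monomial V T' i (u k) / s k)" for k
  have I2: "{1..2::nat} = {1, 2}" by auto
  have \<pi>12: "\<pi> 1 = s 1 / (s 1 + \<tau> * s 2)" "\<pi> 2 = \<tau> * s 2 / (s 1 + \<tau> * s 2)"
    by (simp_all add: \<pi>_def)
  have "positive_real (\<pi> 1)" "positive_real (\<pi> 2)"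
    unfolding \<pi>12 by (intro positive_real_divide positive_real_mult s \<tau> S)+
  moreover have "\<pi> 1 + \<pi> 2 = 1"
    unfolding \<pi>12 using n(3) by (simp flip: add_divide_distrib)
  moreover have "\<pi> \<in> affine_space {1..2}" by (simp add: \<pi>_def affine_space_def)
  ultimately have "\<pi> \<in> open_simplex {1..2}" unfolding open_simplex_iff I2 by simp
  moreover have "\<forall>k \<in> {1..2}. p k \<in> graphical_model V E d"
    unfolding graphical_model_eq normalized_image_def I2 p_def s_def using u(1) u2 by blast
  moreover have "x = (\<lambda>i \<in> R. \<Sum>k = 1..2. \<pi> k * p k i)"
  proof
    fix i
    show "x i = (\<lambda>i \<in> R. \<Sum>k = 1..2. \<pi> k * p k i) i"
    proof (cases "i \<in> R")
      case True
      have "\<pi> 1 * p 1 i = monomial V T' i (u 1) / (s 1 + \<tau> * s 2)"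
        unfolding \<pi>12 p_def using n True by simp
      moreover have "\<pi> 2 * p 2 i = \<tau> * monomial V T' i (u 2) / (s 1 + \<tau> * s 2)"
        unfolding \<pi>12 p_def using n True by simp
      moreover have "x i = (monomial V T' i (u 1) + \<tau> * monomial V T' i (u 2)) / (s 1 + \<tau> * s 2)"
        using True unfolding x sum unfolding wi by simp
      ultimately have "x i = (\<Sum>k \<in> {1, 2}. \<pi> k * p k i)" by (simp add: add_divide_distrib)
      then show ?thesis using True unfolding I2 by simp
    qed (simp add: x)
  qed
  ultimately show "x \<in> mixture 2 R (graphical_model V E d)" unfolding mixture_def by blast
qed

section \<open>Dimensions\<close>

lemma sum_T: "(\<Sum>t \<in> {t \<in> T. subordinate V t i}. c t) =
    c b + (\<Sum>t \<in> T'. c t * (if subordinate V t i then 1 else 0))" for c :: "('v \<Rightarrow> nat) \<Rightarrow> complex"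
proof -
  have "(\<Sum>t \<in> {t \<in> T. subordinate V t i}. c t) = (\<Sum>t \<in> T. c t * (if subordinate V t i then 1 else 0))"
    using finite_T by (simp add: sum.inter_filter if_distrib[of "\<lambda>x. _ * x"] cong: if_cong)
  then show ?thesis
    using sum.remove[OF finite_T b_in_T, of "\<lambda>t. c t * (if subordinate V t i then 1 else 0)"]
    by (simp add: subordinate_base)
qed

text \<open>At the point with all parameters one, the columns of the Jacobian are the indicators of
  subordination.\<close>

lemma dim_model: "model_dim R (graphical_model V E d) = enat (card T')"
proof -
  interpret P: parametrization R T' "monomial V T'" by (rule parametrization_model)
  let ?D = "\<lambda>i t. if subordinate V t i then 1 else (0 :: complex)"
  have "immersion R T' (monomial V T') (\<lambda>_. 1) ?D"
  proof
    show "(\<lambda>_. 1) \<in> orthant T'" by (simp add: orthant_def)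
    show "((\<lambda>s. monomial V T' i (\<lambda>t. 1 + s * v t)) has_field_derivative (\<Sum>t \<in> T'. v t * ?D i t)) (at 0)"
      for i v
      using monomial_derivative[of T' "\<lambda>_. 1" V i v] finite_T
      by (simp add: monomial_one cong: if_cong)
    fix c0 c
    assume zero: "\<And>i. i \<in> R \<Longrightarrow> c0 * monomial V T' i (\<lambda>_. 1) + (\<Sum>t \<in> T'. c t * ?D i t) = 0"
    let ?c = "c(b := c0)"
    have "(\<Sum>t \<in> {t \<in> T. subordinate V t i}. ?c t) = 0" if "i \<in> R" for i
    proof -
      have "(\<Sum>t \<in> T'. ?c t * ?D i t) = (\<Sum>t \<in> T'. c t * ?D i t)" by (intro sum.cong) auto
      then show ?thesis using zero[OF that] unfolding sum_T by (simp add: monomial_def)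
    qed
    then have c: "?c t = 0" if "t \<in> T" for t
      using interaction_expansion_unique[OF finite_V _ that] by blast
    have "c t = 0" if "t \<in> T'" for t using c[of t] that by simp
    then show "c0 = 0 \<and> (\<forall>t \<in> T'. c t = 0)" using c[OF b_in_T] by simp
  qed
  then show ?thesis
    unfolding graphical_model_eq by (rule immersion.model_dim_normalized_image)
qed

text \<open>The point chosen has all parameters of the first component equal to one, so that its monomials
  are one, and those of the second such that its monomials are the values of the weight \<open>r\<close>. A vector
  in the kernel of the Jacobian then has the form \<open>g + r * h = 0\<close> with \<open>g\<close> and \<open>h\<close> sums of
  interactions.\<close>

lemma dim_mixture:
  assumes dec: "decomposable V E" and star: "\<not> clique_star V E"
  shows "model_dim R (mixture 2 R (graphical_model V E d)) = enat (card mixture_index)"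
proof -
  interpret P: parametrization R mixture_index mixture_coord by (rule parametrization_mixture)
  define r where "r i = complex_of_real (exp (quadratic_weight V E i))" for i
  interpret W: transversal_weight V E d r
    unfolding r_def by (rule transversal_quadratic_weight[OF simple two_states])
  have transversal: "h i = 0"
    if h: "additive V E d h" and g: "additive V E d g"
      and gh: "\<And>i. i \<in> R \<Longrightarrow> g i + r i * h i = 0" and i: "i \<in> R" for g h i
    using simple dec star
  proof (cases rule: not_clique_star_cases)
    case (triple u v w)
    then show ?thesis using W.transversal_triple[OF h g gh] i by blast
  next
    case (path s p q t)
    then show ?thesis using W.transversal_path[OF h g gh] i by blast
  qed
  let ?\<theta> = "\<lambda>(C, j). exp ((\<Sum>v \<in> C. real (j v))\<^sup>2)"
  have "0 < ?\<theta> x" for x by (simp add: case_prod_unfold)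
  then obtain \<psi> where \<psi>: "\<And>t. 0 < \<psi> t" "\<And>i. i \<in> R \<Longrightarrow>
    (\<Prod>C \<in> max_cliques V E. ?\<theta> (C, restrict i C)) = monomial V T i \<psi>"
    using monomial_of_clique_factors[of V d ?\<theta> E] finite_V two_states by blast
  let ?w = "\<lambda>t. complex_of_real (\<psi> t)"
  have w0: "?w t \<noteq> 0" for t using \<psi>(1)[of t] by simp
  have rw: "monomial V T i ?w = r i" if i: "i \<in> R" for i
  proof -
    have "monomial V T i ?w = complex_of_real (\<Prod>C \<in> max_cliques V E. ?\<theta> (C, restrict i C))"
      unfolding \<psi>(2)[OF i] by (simp add: monomial_def)
    then show ?thesis
      by (simp add: r_def quadratic_weight_def exp_sum finite_max_cliques[OF finite_V])
  qed
  let ?W = "\<lambda>(k :: nat, t). if k = 1 then 1 else ?w t"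
  let ?S = "\<lambda>i t. if subordinate V t i then 1 else (0 :: complex)"
  let ?D = "\<lambda>i (k :: nat, t). if k = 1 then ?S i t else r i / ?w t * ?S i t"
  have split: "(\<Sum>x \<in> mixture_index. F x) = (\<Sum>t \<in> T'. F (1, t)) + (\<Sum>t \<in> T. F (2, t))"
    for F :: "nat \<times> ('v \<Rightarrow> nat) \<Rightarrow> complex"
  proof -
    have "(\<Sum>x \<in> {k} \<times> A. F x) = (\<Sum>t \<in> A. F (k, t))" for k and A :: "('v \<Rightarrow> nat) set"
    proof -
      have "{k} \<times> A = Pair k ` A" by auto
      then show ?thesis by (simp add: sum.reindex inj_on_def)
    qed
    then show ?thesis
      unfolding mixture_index_def using finite_T by (subst sum.union_disjoint) auto
  qed
  have "immersion R mixture_index mixture_coord ?W ?D"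
  proof
    show "?W \<in> orthant mixture_index" using \<psi>(1) by (auto simp: orthant_def)
    show "((\<lambda>s. mixture_coord i (\<lambda>x. ?W x + s * v x)) has_field_derivative
        (\<Sum>x \<in> mixture_index. v x * ?D i x)) (at 0)" if i: "i \<in> R" for i v
    proof -
      have "((\<lambda>s. monomial V T' i (\<lambda>t. 1 + s * v (1, t))) has_field_derivative
          (\<Sum>t \<in> T'. v (1, t) * ?S i t)) (at 0)"
        using monomial_derivative[of T' "\<lambda>_. 1" V i "\<lambda>t. v (1, t)"] finite_T
        by (simp add: monomial_one cong: if_cong)
      moreover have "((\<lambda>s. monomial V T i (\<lambda>t. ?w t + s * v (2, t))) has_field_derivative
          (\<Sum>t \<in> T. v (2, t) * (r i / ?w t * ?S i t))) (at 0)"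
      proof -
        have "(\<Sum>t \<in> T. v (2, t) * (if subordinate V t i then monomial V T i ?w / ?w t else 0)) =
          (\<Sum>t \<in> T. v (2, t) * (r i / ?w t * ?S i t))"
          unfolding rw[OF i] by (intro sum.cong) auto
        then show ?thesis using monomial_derivative[OF finite_T, of ?w V i "\<lambda>t. v (2, t)"] w0 by simp
      qed
      ultimately show ?thesis
        unfolding mixture_coord_def split using DERIV_add by fastforce
    qed
    fix c0 c
    assume zero: "\<And>i. i \<in> R \<Longrightarrow> c0 * mixture_coord i ?W + (\<Sum>x \<in> mixture_index. c x * ?D i x) = 0"
    \<comment> \<open>The coefficient \<open>c0\<close> of the point itself contributes a constant to both \<open>g\<close> and \<open>h\<close>, that is a
      multiple of the interaction of the base state.\<close>
    define cg where "cg t = (if t = b then c0 else c (1, t))" for t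
    define ch where "ch t = c (2, t) / ?w t + (if t = b then c0 else 0)" for t
    let ?g = "\<lambda>i. \<Sum>t \<in> {t \<in> T. subordinate V t i}. cg t"
    let ?h = "\<lambda>i. \<Sum>t \<in> {t \<in> T. subordinate V t i}. ch t"
    have gh: "?g i + r i * ?h i = 0" if i: "i \<in> R" for i
    proof -
      have g: "?g i = c0 + (\<Sum>t \<in> T'. c (1, t) * ?S i t)"
        unfolding sum_T by (simp add: cg_def)
      have "?h i = c (2, b) / ?w b + c0 + (\<Sum>t \<in> T'. c (2, t) / ?w t * ?S i t)"
        unfolding sum_T by (simp add: ch_def)
      also have "\<dots> = c0 + (\<Sum>t \<in> T. c (2, t) / ?w t * ?S i t)"
        using sum.remove[OF finite_T b_in_T, of "\<lambda>t. c (2, t) / ?w t * ?S i t"]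
        by (simp add: subordinate_base)
      finally have h: "r i * ?h i = r i * c0 + (\<Sum>t \<in> T. c (2, t) * (r i / ?w t * ?S i t))"
        by (simp add: distrib_left sum_distrib_left mult_ac)
      have "mixture_coord i ?W = 1 + r i"
        using rw[OF i] by (simp add: mixture_coord_def monomial_def)
      then show ?thesis using zero[OF i] unfolding g h split by (simp add: algebra_simps)
    qed
    have h0: "?h i = 0" if "i \<in> R" for i
      by (rule transversal[OF additive_interactions[OF finite_V] additive_interactions[OF finite_V] gh that])
    have g0: "?g i = 0" if "i \<in> R" for i using gh[OF that] h0[OF that] by simp
    have cg: "cg t = 0" and ch: "ch t = 0" if "t \<in> T" for t
      using interaction_expansion_unique[OF finite_V g0 that]
        interaction_expansion_unique[OF finite_V h0 that] by auto
    have c0: "c0 = 0" using cg[OF b_in_T] by (simp add: cg_def)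
    have "c (1, t) = 0" if "t \<in> T'" for t using cg[of t] that by (simp add: cg_def)
    moreover have "c (2, t) = 0" if "t \<in> T" for t 
      using ch[OF that] w0[of t] c0 by (cases "t = b") (simp_all add: ch_def)
    ultimately show "c0 = 0 \<and> (\<forall>x \<in> mixture_index. c x = 0)"
      using c0 by (auto simp: mixture_index_def)
  qed
  then show ?thesis
    unfolding mixture_eq by (rule immersion.model_dim_normalized_image)
qed

lemma card_mixture_index: "card mixture_index = 2 * card T' + 1"
proof -
  have "card mixture_index = card T' + card T"
    unfolding mixture_index_def using finite_T
    by (subst card_Un_disjoint) (auto simp: card_cartesian_product)
  also have "card T = card T' + 1"
    using card.remove[OF finite_T b_in_T] by simp
  finally show ?thesis by simp
qed

end

theorem theorem4p15:
  fixes V :: "'v set" and E :: "'v set set" and d :: "'v \<Rightarrow> nat"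
  assumes "simple_graph V E"
    and "decomposable V E"
    and "\<not> clique_star V E"
    and "\<And>v. v \<in> V \<Longrightarrow> 2 \<le> d v"
  shows "model_dim (states d V) (mixture 2 (states d V) (graphical_model V E d)) =
         2 * model_dim (states d V) (graphical_model V E d) + 1"
proof -
  interpret graph_states V E d using assms(1,4) by unfold_locales
  show ?thesis
    unfolding dim_mixture[OF assms(2,3)] dim_model card_mixture_index
    by (simp add: one_enat_def numeral_eq_enat)
qed

end
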